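(* Let $E=(M(1),\dots,M(n))$ be an ordered collection of multiplicity sequences, let $T\in\tau(E)$ with matrix entries $p_{q,r}$ ($1\le q<r\le n$), and let $S(T)\in\sigma(E)$ be the corresponding Arf semigroup. Let $P=\{(q,r): 1\le q<r\le n,\ p_{q,r}=k_E(q,r)\}$. A finite set $G(T)=\{\mathrm{Gen}(1),\dots,\mathrm{Gen}(t)\}\subseteq\mathbb N^n$ is such that $\mathrm{Arf}(G(T))=S(T)$ (in particular $\mathrm{Arf}(G(T))$ is well defined) if and only if the following conditions hold: (1) $\mathrm{Gen}(1)=V_E(j_{1,1},\dots,j_{1,n}),\ \dots,\ \mathrm{Gen}(t)=V_E(j_{t,1},\dots,j_{t,n})$ for some values of the indices $j_{1,1},\dots,j_{t,n}$ (nonnegative integers); (2) $\mathrm{PChar}_E(i)\subseteq\{j_{1,i},\dots,j_{t,i}\}$ for all $i=1,\dots,n$; and, setting $$\mathrm{MIN}_{G(T)}(q,r)=\min\Bigl(k_E(q,r),\ \min\{\min(j_{p,q},j_{p,r}): j_{p,q}\ne j_{p,r},\ p=1,\dots,t\}\Bigr)$$ for those pairs $q<r$ for which it is well defined (i.e. for which $j_{p,q}\neq j_{p,r}$ for some $p$), (3) for every $(q,r)\in P$, either $j_{p,q}=j_{p,r}$ for all $p=1,\dots,t$, or $\mathrm{MIN}_{G(T)}(q,r)$ is well defined and equals $k_E(q,r)$; (4) for every pair $q<r$ with $(q,r)\notin P$, $\mathrm{MIN}_{G(T)}(q,r)$ is well defined and equals $p_{q,r}$.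
   Context: $\mathbb N=\{0,1,2,\dots\}$; $v[i]$ is the $i$-th component of $v$; $\mathbb N^n$ has the componentwise order and $\min(a,b)$ is the componentwise minimum. Arf semigroups. A good semigroup $S$ of $\mathbb N^n$ is a submonoid of $(\mathbb N^n,+)$ such that: (i) $\min(a,b)\in S$ for $a,b\in S$; (ii) if $a\neq b$ in $S$ and $a[i]=b[i]$, then there is $c\in S$ with $c[i]>a[i]$, $c[j]\ge\min(a[j],b[j])$ for $j\ne i$, with equality whenever $a[j]\ne b[j]$; (iii) there is $\delta\in S$ with $\delta+\mathbb N^n\subseteq S$. It is local if $\mathbf 0$ is its only element with a zero component. An Arf semigroup of $\mathbb N^n$ is here a local good semigroup $S$ such that $\{\beta\in S:\beta\ge\alpha\}-\alpha$ is a semigroup for every $\alpha\in S$. For $G\subseteq\mathbb N^n$, $\mathrm{Arf}(G)$ denotes the minimum, with respect to inclusion, of the set of Arf semigroups of $\mathbb N^n$ containing $G$; it is well defined if this minimum exists. Multiplicity sequences. A multiplicity sequence is a sequence $M(i)=(m_{i,l})_{l\ge1}$ of positive integers, equal to $1$ for all large $l$, such that for every $l\ge 1$ there is a (unique) $s_{i,l}\ge l+1$ with $m_{i,l}=\sum_{k=l+1}^{s_{i,l}}m_{i,k}$. For $q<r$ let $D(q,r)=\{k:s_{q,k}\ne s_{r,k}\}$, and $k_E(q,r)=\min\{\min(s_{q,k},s_{r,k}):k\in D(q,r)\}$ if $D(q,r)\ne\emptyset$, $k_E(q,r)=+\infty$ otherwise. Trees. $\tau(E)$ is the set of trees $T$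 with $n$ infinite branches and nodes labelled by vectors of $\mathbb N^n$, $\mathbf n_i^l$ being the node of the $i$-th branch at level $l\ge1$ (joined to $\mathbf n_i^{l+1}$), such that: all branches are glued at level $1$ (branches $i,j$ are glued at level $l$ if $\mathbf n_i^l$ and $\mathbf n_j^l$ are the same node; then they are glued at all lower levels); $\mathbf n_i^l[i]=m_{i,l}$; for all large $l$, $\mathbf n_i^l$ is the $i$-th unit vector; $\mathbf n_i^l[h]=0$ if and only if $\mathbf n_i^l$ is not in the $h$-th branch; and each $\mathbf n_i^l$ equals the sum of the nodes other than $\mathbf n_i^l$ itself in some finite subtree of $T$ rooted in $\mathbf n_i^l$. For $T\in\tau(E)$, $p_{q,r}$ ($q<r$) is the highest level at which branches $q$ and $r$ are glued; these are the entries above the diagonal of the upper triangular matrix $M(T)_E$ representing $T$. The semigroup of $T$ is $S(T)=\{\mathbf 0\}\cup\{\sum_{\mathbf n\in T'}\mathbf n: T'\text{ a finite subtree of }T\text{ rooted in the root }\mathbf n_1^1\}$; it is an Arf semigroup, and $\sigma(E)=\{S(T):T\in\tau(E)\}$. Characters. The restriction number $r(m_{i,j})$ is the number of the sums $m_{i,q}=\sum_{h=1}^{k}m_{i,q+h}$ in which $m_{i,j}$ appears as a summand, i.e. the number of $q<j$ with $s_{i,q}\ge j$. $\mathrm{PChar}_E(i)=\{j\ge1: r(m_{i,j})<r(m_{i,j+1})\}$. $V_E(j_1,\dots,j_n)=\left[\sum_{k=1}^{j_1}m_{1,k},\dots,\sum_{k=1}^{j_n}m_{n,k}\right]$ (an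 empty sum being $0$). *)

theory Defs
  imports "HOL-Analysis.Finite_Cartesian_Product" "HOL-Library.Extended_Nat"
begin

text \<open>
  The monoid of vectors of length \<open>n\<close> over the naturals is \<open>nat ^ 'n\<close>, with the library's
  componentwise order. The branch indices \<open>1 < \<dots> < n\<close> are the elements of the finite linear order
  \<open>'n\<close>. Levels of sequences and trees start at \<open>1\<close>; values at \<open>0\<close> are irrelevant.
\<close>

section \<open>Arf semigroups\<close>

definition vmin :: "nat ^ 'n \<Rightarrow> nat ^ 'n \<Rightarrow> nat ^ 'n" where
  "vmin a b = (\<chi> i. min (a $ i) (b $ i))"

definition submonoid_vec :: "(nat ^ 'n) set \<Rightarrow> bool" where
  "submonoid_vec S \<longleftrightarrow> 0 \<in> S \<and> (\<forall>a\<in>S. \<forall>b\<in>S. a + b \<in> S)"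

definition good_semigroup :: "(nat ^ 'n) set \<Rightarrow> bool" where
  "good_semigroup S \<longleftrightarrow>
     submonoid_vec S \<and>
     (\<forall>a\<in>S. \<forall>b\<in>S. vmin a b \<in> S) \<and>
     (\<forall>a\<in>S. \<forall>b\<in>S. \<forall>i. a \<noteq> b \<and> a $ i = b $ i \<longrightarrow>
        (\<exists>c\<in>S. c $ i > a $ i \<and>
           (\<forall>j. j \<noteq> i \<longrightarrow> c $ j \<ge> min (a $ j) (b $ j) \<and>
                (a $ j \<noteq> b $ j \<longrightarrow> c $ j = min (a $ j) (b $ j))))) \<and>
     (\<exists>\<delta>\<in>S. \<forall>v. \<delta> + v \<in> S)"

definition local_semigroup :: "(nat ^ 'n) set \<Rightarrow> bool" where
  "local_semigroup S \<longleftrightarrow> (\<forall>a\<in>S. (\<exists>i. a $ i = 0) \<longrightarrow> a = 0)"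

text \<open>The truncated subtraction \<open>\<beta> - \<alpha>\<close> below is exact because \<open>\<alpha> \<le> \<beta>\<close>.\<close>

definition Arf_semigroup :: "(nat ^ 'n) set \<Rightarrow> bool" where
  "Arf_semigroup S \<longleftrightarrow> good_semigroup S \<and> local_semigroup S \<and>
     (\<forall>\<alpha>\<in>S. \<forall>x \<in> {\<beta> - \<alpha> | \<beta>. \<beta> \<in> S \<and> \<alpha> \<le> \<beta>}. \<forall>y \<in> {\<beta> - \<alpha> | \<beta>. \<beta> \<in> S \<and> \<alpha> \<le> \<beta>}.
        x + y \<in> {\<beta> - \<alpha> | \<beta>. \<beta> \<in> S \<and> \<alpha> \<le> \<beta>})"

definition is_Arf_closure :: "(nat ^ 'n) set \<Rightarrow> (nat ^ 'n) set \<Rightarrow> bool" where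
  "is_Arf_closure G S \<longleftrightarrow> Arf_semigroup S \<and> G \<subseteq> S \<and>
     (\<forall>S'. Arf_semigroup S' \<and> G \<subseteq> S' \<longrightarrow> S \<subseteq> S')"

definition Arf_well_defined :: "(nat ^ 'n) set \<Rightarrow> bool" where
  "Arf_well_defined G \<longleftrightarrow> (\<exists>S. is_Arf_closure G S)"

text \<open>Meaningful only under \<^const>\<open>Arf_well_defined\<close>.\<close>

definition Arf :: "(nat ^ 'n) set \<Rightarrow> (nat ^ 'n) set" where
  "Arf G = (THE S. is_Arf_closure G S)"

section \<open>Multiplicity sequences\<close>

definition is_sum_end :: "(nat \<Rightarrow> nat) \<Rightarrow> nat \<Rightarrow> nat \<Rightarrow> bool" where
  "is_sum_end m l s \<longleftrightarrow> l + 1 \<le> s \<and> m l = (\<Sum>k = l+1..s. m k)"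

definition multiplicity_sequence :: "(nat \<Rightarrow> nat) \<Rightarrow> bool" where
  "multiplicity_sequence m \<longleftrightarrow>
     (\<forall>l\<ge>1. m l > 0) \<and> (\<exists>L. \<forall>l\<ge>L. m l = 1) \<and> (\<forall>l\<ge>1. \<exists>s. is_sum_end m l s)"

definition sum_end :: "(nat \<Rightarrow> nat) \<Rightarrow> nat \<Rightarrow> nat" where
  "sum_end m l = (THE s. is_sum_end m l s)"

lemma is_sum_end_unique:
  assumes "multiplicity_sequence m" "is_sum_end m l s" "is_sum_end m l s'"
  shows "s = s'"
proof -
  have less: False if "is_sum_end m l a" "is_sum_end m l b" "a < b" for a b
  proof -
    have "m b > 0" using that(1,3) assms(1) by (auto simp: is_sum_end_def multiplicity_sequence_def)
    moreover have "(\<Sum>k = l+1..a. m k) + m b = (\<Sum>k \<in> insert b {l+1..a}. m k)"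
      using that(3) by simp
    moreover have "\<dots> \<le> (\<Sum>k = l+1..b. m k)"
      using that by (intro sum_mono2) (auto simp: is_sum_end_def)
    ultimately have "(\<Sum>k = l+1..a. m k) < (\<Sum>k = l+1..b. m k)" by linarith
    then show False using that by (simp add: is_sum_end_def)
  qed
  show ?thesis using less[of s s'] less[of s' s] assms(2,3) by (metis linorder_less_linear)
qed

text \<open>The collection \<open>E\<close> is a function from branch indices to sequences. The infimum of the empty
  set in \<^typ>\<open>enat\<close> is \<open>\<infinity>\<close>, which covers the case \<open>D = {}\<close>.\<close>

definition D_set :: "('n \<Rightarrow> nat \<Rightarrow> nat) \<Rightarrow> 'n \<Rightarrow> 'n \<Rightarrow> nat set" where
  "D_set E q r = {k. 1 \<le> k \<and> sum_end (E q) k \<noteq> sum_end (E r) k}"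

definition k_E :: "('n \<Rightarrow> nat \<Rightarrow> nat) \<Rightarrow> 'n \<Rightarrow> 'n \<Rightarrow> enat" where
  "k_E E q r = (INF k \<in> D_set E q r. enat (min (sum_end (E q) k) (sum_end (E r) k)))"

section \<open>Trees\<close>

text \<open>
  A tree is given by the nodes \<open>node T i l\<close> of its branches (over an arbitrary type \<open>'v\<close> of nodes)
  and the labelling \<open>lab T\<close>. Branches are glued at a level when they have the same node there.
\<close>

record ('n, 'v) ltree =
  node :: "'n \<Rightarrow> nat \<Rightarrow> 'v"
  lab :: "'v \<Rightarrow> nat ^ 'n"

definition nodes :: "('n::finite, 'v) ltree \<Rightarrow> 'v set" where
  "nodes T = {node T i l | i l. 1 \<le> l}"

definition branch :: "('n::finite, 'v) ltree \<Rightarrow> 'n \<Rightarrow> 'v set" where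
  "branch T i = {node T i l | l. 1 \<le> l}"

definition edges :: "('n::finite, 'v) ltree \<Rightarrow> ('v \<times> 'v) set" where
  "edges T = {(node T i l, node T i (Suc l)) | i l. 1 \<le> l}"

definition glued :: "('n::finite, 'v) ltree \<Rightarrow> 'n \<Rightarrow> 'n \<Rightarrow> nat \<Rightarrow> bool" where
  "glued T i j l \<longleftrightarrow> node T i l = node T j l"

text \<open>Finite subtrees with root \<open>x\<close>; edges are directed away from the root of \<open>T\<close>.\<close>

definition finite_subtree :: "('n::finite, 'v) ltree \<Rightarrow> 'v \<Rightarrow> 'v set \<Rightarrow> bool" where
  "finite_subtree T x U \<longleftrightarrow> finite U \<and> U \<subseteq> nodes T \<and> x \<in> U \<and>
     (\<forall>y\<in>U. (x, y) \<in> (edges T \<inter> U \<times> U)\<^sup>*)"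

text \<open>The first two conjuncts say that \<open>T\<close> is a tree with levels: nodes of different levels are
  different, and branches glued at a level are glued at all lower ones.\<close>

definition tau :: "('n::finite \<Rightarrow> nat \<Rightarrow> nat) \<Rightarrow> ('n, 'v) ltree set" where
  "tau E = {T.
     (\<forall>i j l l'. 1 \<le> l \<and> 1 \<le> l' \<and> node T i l = node T j l' \<longrightarrow> l = l') \<and>
     (\<forall>i j l l'. 1 \<le> l' \<and> l' \<le> l \<and> glued T i j l \<longrightarrow> glued T i j l') \<and>
     (\<forall>i j. glued T i j 1) \<and>
     (\<forall>i. \<forall>l\<ge>1. lab T (node T i l) $ i = E i l) \<and>
     (\<exists>L. \<forall>l\<ge>L. \<forall>i. lab T (node T i l) = axis i 1) \<and>
     (\<forall>i h. \<forall>l\<ge>1. lab T (node T i l) $ h = 0 \<longleftrightarrow> node T i l \<notin> branch T h) \<and>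
     (\<forall>i. \<forall>l\<ge>1. \<exists>U. finite_subtree T (node T i l) U \<and>
        lab T (node T i l) = (\<Sum>x \<in> U - {node T i l}. lab T x))}"

definition glue_level :: "('n::finite, 'v) ltree \<Rightarrow> 'n \<Rightarrow> 'n \<Rightarrow> nat" where
  "glue_level T q r = Max {l. 1 \<le> l \<and> glued T q r l}"

definition root :: "('n::{finite,linorder}, 'v) ltree \<Rightarrow> 'v" where
  "root T = node T (Min UNIV) 1"

definition tree_semigroup :: "('n::{finite,linorder}, 'v) ltree \<Rightarrow> (nat, 'n) vec set" where
  "tree_semigroup T = {0} \<union> {(\<Sum>x\<in>U. lab T x) | U. finite_subtree T (root T) U}"

section \<open>Characters and generators\<close>

definition restriction_number :: "(nat \<Rightarrow> nat) \<Rightarrow> nat \<Rightarrow> nat" where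
  "restriction_number m j = card {q. 1 \<le> q \<and> q < j \<and> j \<le> sum_end m q}"

definition PChar :: "('n \<Rightarrow> nat \<Rightarrow> nat) \<Rightarrow> 'n \<Rightarrow> nat set" where
  "PChar E i = {j. 1 \<le> j \<and> restriction_number (E i) j < restriction_number (E i) (j + 1)}"

definition V_E :: "('n \<Rightarrow> nat \<Rightarrow> nat) \<Rightarrow> ('n \<Rightarrow> nat) \<Rightarrow> nat ^ 'n" where
  "V_E E js = (\<chi> i. \<Sum>k = 1..js i. E i k)"

text \<open>In the following, \<open>j p i\<close> is the \<open>i\<close>-th index of the \<open>p\<close>-th generator, \<open>1 \<le> p \<le> t\<close>.\<close>

definition MIN_well_defined :: "nat \<Rightarrow> (nat \<Rightarrow> 'n \<Rightarrow> nat) \<Rightarrow> 'n \<Rightarrow> 'n \<Rightarrow> bool" where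
  "MIN_well_defined t j q r \<longleftrightarrow> (\<exists>p\<in>{1..t}. j p q \<noteq> j p r)"

definition MIN_G ::
  "('n \<Rightarrow> nat \<Rightarrow> nat) \<Rightarrow> nat \<Rightarrow> (nat \<Rightarrow> 'n \<Rightarrow> nat) \<Rightarrow> 'n \<Rightarrow> 'n \<Rightarrow> enat" where
  "MIN_G E t j q r =
     min (k_E E q r) (enat (Min {min (j p q) (j p r) | p. p \<in> {1..t} \<and> j p q \<noteq> j p r}))"

definition P_set ::
  "('n::{finite,linorder} \<Rightarrow> nat \<Rightarrow> nat) \<Rightarrow> ('n, 'v) ltree \<Rightarrow> ('n \<times> 'n) set" where
  "P_set E T = {(q, r). q < r \<and> enat (glue_level T q r) = k_E E q r}"

end

theory Submission
  imports Defs
begin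

text \<open>
  \<open>S(T)\<close> consists of the vectors \<open>V_E j\<close> with \<open>min (j q) l = min (j r) l\<close> whenever the
  branches \<open>q\<close> and \<open>r\<close> are glued at level \<open>l\<close>. Any such set is an Arf semigroup provided that the
  ends of the sums satisfy the same equations, and it remains one when finitely many indices \<open>j i\<close>
  are forbidden that are not ends of sums, i.e. that lie in \<open>PChar_E(i)\<close>. If a character is missing
  from the generators, or if the generators do not separate two branches that could be glued one
  level further, then forbidding that character, or gluing the branches, gives an Arf semigroup that
  contains the generators but not \<open>S(T)\<close>.

  Conversely, an Arf semigroup is closed under componentwise minima and maxima and under
  \<open>x + y - z\<close> for \<open>z \<le> x, y\<close>. Hence a vector belongs to it as soon as, for each pair \<open>(q, r)\<close>, it
  has an element with the right \<open>q\<close>-th entry and a sufficiently large \<open>r\<close>-th entry. Below the level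
  where the branches separate, such elements are built by induction from the characters, because the
  entry at the end \<open>s\<close> of the sum for \<open>k\<close> is twice the entry at \<open>k\<close> minus the one at \<open>k - 1\<close>;
  above it, from an element separating the branches and the exchange property of good semigroups.
\<close>

section \<open>Partial sums of a multiplicity sequence\<close>

definition psum :: "(nat \<Rightarrow> nat) \<Rightarrow> nat \<Rightarrow> nat" where
  "psum m a = (\<Sum>k = 1..a. m k)"

lemma psum_0 [simp]: "psum m 0 = 0"
  by (simp add: psum_def)

lemma psum_Suc: "psum m (Suc a) = psum m a + m (Suc a)"
  by (simp add: psum_def)

lemma V_E_nth: "V_E E j $ i = psum (E i) (j i)"
  by (simp add: V_E_def psum_def)

locale mult_seq =
  fixes m :: "nat \<Rightarrow> nat"
  assumes mult: "multiplicity_sequence m"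
begin

lemma pos: "l \<ge> 1 \<Longrightarrow> m l > 0"
  using mult by (simp add: multiplicity_sequence_def)

lemma psum_strict_mono: "strict_mono (psum m)"
  unfolding strict_mono_Suc_iff psum_Suc using pos by simp

lemma psum_le_iff [simp]: "psum m a \<le> psum m b \<longleftrightarrow> a \<le> b"
  by (rule strict_mono_less_eq[OF psum_strict_mono])

lemma psum_less_iff [simp]: "psum m a < psum m b \<longleftrightarrow> a < b"
  by (rule strict_mono_less[OF psum_strict_mono])

lemma psum_eq_iff [simp]: "psum m a = psum m b \<longleftrightarrow> a = b"
  by (rule strict_mono_eq[OF psum_strict_mono])

lemma le_psum: "a \<le> psum m a"
  by (rule strict_mono_imp_increasing[OF psum_strict_mono])

lemma is_sum_end_sum_end: "l \<ge> 1 \<Longrightarrow> is_sum_end m l (sum_end m l)"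
  unfolding sum_end_def using mult is_sum_end_unique[OF mult]
  by (metis multiplicity_sequence_def theI)

lemma sum_end_eqI: "is_sum_end m l s \<Longrightarrow> l \<ge> 1 \<Longrightarrow> sum_end m l = s"
  using is_sum_end_unique[OF mult] is_sum_end_sum_end by blast

lemma sum_end_gt: "l \<ge> 1 \<Longrightarrow> l < sum_end m l"
  using is_sum_end_sum_end[of l] by (simp add: is_sum_end_def)

lemma psum_split: "a \<le> b \<Longrightarrow> psum m b = psum m a + (\<Sum>k = a+1..b. m k)"
  unfolding psum_def using sum.ub_add_nat[of 1 a m "b - a"] by simp

lemma psum_sum_end: "psum m (sum_end m (Suc a)) + psum m a = 2 * psum m (Suc a)"
proof -
  have "psum m (sum_end m (Suc a)) = psum m (Suc a) + m (Suc a)"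
    using is_sum_end_sum_end[of "Suc a"] psum_split[of "Suc a" "sum_end m (Suc a)"]
    by (simp add: is_sum_end_def)
  then show ?thesis by (simp add: psum_Suc)
qed

lemma eventually_one: obtains L where "\<And>l. l \<ge> L \<Longrightarrow> m l = 1"
  using mult by (auto simp: multiplicity_sequence_def)

lemma psum_eventually:
  assumes "\<And>l. l \<ge> L \<Longrightarrow> m l = 1"
  shows "psum m (L + d) = psum m L + d"
  by (induction d) (use assms in \<open>auto simp: psum_Suc\<close>)

lemma sum_end_eventually:
  assumes "\<And>l. l \<ge> L \<Longrightarrow> m l = 1" "l \<ge> L" "l \<ge> 1"
  shows "sum_end m l = Suc l"
  by (rule sum_end_eqI) (use assms in \<open>auto simp: is_sum_end_def\<close>)

text \<open>The recursion behind \<open>Arf_index_exists\<close> and \<open>Arf_index_cong\<close>: if \<open>u\<close> is the index for \<open>(a + 1, b, d)\<close>, then the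
  index for \<open>(a, b, d)\<close> with \<open>a < b, d\<close> is the one for \<open>(a + 1, u, s)\<close>, where \<open>s\<close> is the end of the
  sum expressing the entry \<open>a + 1\<close>.\<close>

lemma Arf_index_exists:
  assumes "a \<le> b" "a \<le> d"
  shows "\<exists>f. psum m f + psum m a = psum m b + psum m d \<and> (f = b \<or> f = d \<or> f \<in> sum_end m ` {1..})"
proof -
  obtain L where L: "\<And>l. l \<ge> L \<Longrightarrow> m l = 1" by (rule eventually_one) blast
  show ?thesis using assms
  proof (induction "L - a" arbitrary: a b d rule: less_induct)
    case less
    show ?case
    proof (cases "b = a \<or> d = a")
      case True then show ?thesis by (metis add.commute)
    next
      case False
      then have lt: "Suc a \<le> b" "Suc a \<le> d" using less.prems by auto
      show ?thesis
      proof (cases "L \<le> a")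
        case True
        have e: "psum m (L + c) = psum m L + c" for c using psum_eventually L by blast
        obtain x y z where x: "a = L + x" "b = L + (x + Suc y)" "d = L + (x + Suc z)"
          using that[of "a - L" "b - Suc a" "d - Suc a"] True lt by simp
        have "psum m (L + (x + Suc y + Suc z)) + psum m a = psum m b + psum m d"
          unfolding x e by simp
        \<comment> \<open>From \<open>L\<close> on every sum has a single term, so the successor of
          a positive level at least \<open>L\<close> is itself the end of a sum.\<close>
        moreover have "L + (x + Suc y + Suc z) = sum_end m (L + x + Suc y + z)"
          by (subst sum_end_eventually[of L]) (use L in auto)
        ultimately show ?thesis by (intro exI[of _ "L + (x + Suc y + Suc z)"]) auto
      next
        case False
        obtain u where u: "psum m u + psum m (Suc a) = psum m b + psum m d"
          "u = b \<or> u = d \<or> u \<in> sum_end m ` {1..}"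
          using less.hyps[of "Suc a" b d] lt False by (metis diff_less_mono2 lessI not_le)
        have "Suc a \<le> u"
          using u(1) lt by (metis add_le_imp_le_right add_mono psum_le_iff)
        moreover have "Suc a \<le> sum_end m (Suc a)" using sum_end_gt[of "Suc a"] by simp
        ultimately obtain f where f: "psum m f + psum m (Suc a) = psum m u + psum m (sum_end m (Suc a))"
          "f = u \<or> f = sum_end m (Suc a) \<or> f \<in> sum_end m ` {1..}"
          using less.hyps[of "Suc a" u "sum_end m (Suc a)"] False by (metis diff_less_mono2 lessI not_le)
        have "psum m f + psum m a = psum m b + psum m d"
          using f(1) u(1) psum_sum_end[of a] by linarith
        then show ?thesis using f(2) u(2) by (intro exI[of _ f]) auto
      qed
    qed
  qed
qed

lemma Arf_index_ge:
  assumes "psum m f + psum m a = psum m b + psum m d" "a \<le> b"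
  shows "d \<le> f"
  using assms by (metis add_le_cancel_left add_le_imp_le_right add.commute psum_le_iff)

end

text \<open>The recursion uses only \<open>a\<close>, \<open>b\<close>, \<open>d\<close> and the
  ends of sums, so truncating these at \<open>l\<close> determines the result truncated at
  \<open>l\<close>. This carries the equations between glued branches over to
  \<open>x + y - z\<close>.\<close>

lemma Arf_index_cong:
  assumes "multiplicity_sequence m" "multiplicity_sequence m'"
    and s: "\<And>k. k \<ge> 1 \<Longrightarrow> min (sum_end m k) l = min (sum_end m' k) l"
    and "a \<le> b" "a \<le> d" "a' \<le> b'" "a' \<le> d'"
    and "psum m f + psum m a = psum m b + psum m d"
    and "psum m' f' + psum m' a' = psum m' b' + psum m' d'"
    and "min a l = min a' l" "min b l = min b' l" "min d l = min d' l"
  shows "min f l = min f' l"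
proof -
  interpret m: mult_seq m by standard fact
  interpret m': mult_seq m' by standard fact
  show ?thesis using assms(4-)
  \<comment> \<open>Once \<open>l \<le> a\<close>, every index involved is at least \<open>l\<close>
    and both truncations are \<open>l\<close>; before that, \<open>a'\<close> must equal
    \<open>a\<close>.\<close>
  proof (induction "l - a" arbitrary: a b d a' b' d' f f' rule: less_induct)
    case less
    note p = less.prems
    have ge: "b \<le> f" "d \<le> f" "b' \<le> f'" "d' \<le> f'"
      using m.Arf_index_ge[OF p(5,1)] m.Arf_index_ge[OF p(5)[unfolded add.commute[of "psum m b"]] p(2)]
        m'.Arf_index_ge[OF p(6,3)] m'.Arf_index_ge[OF p(6)[unfolded add.commute[of "psum m' b'"]] p(4)]
      by auto
    show ?case
    proof (cases "l \<le> a")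
      case True
      then have "l \<le> a'" using p by auto
      then show ?thesis using True ge p by auto
    next
      case False
      then have aa: "a' = a" using p(7) by (auto simp: min_def split: if_splits)
      consider "b = a" | "d = a" | "a < b" "a < d" using p by linarith
      then show ?thesis
      proof cases
        case 1
        then have "b' = a" using p(8) False by (auto simp: min_def split: if_splits)
        then have "f = d" "f' = d'" using 1 aa p by auto
        then show ?thesis using p by simp
      next
        case 2
        then have "d' = a" using p(9) False by (auto simp: min_def split: if_splits)
        then have "f = b" "f' = b'" using 2 aa p by auto
        then show ?thesis using p by simp
      next
        case 3
        then have gt: "Suc a \<le> b" "Suc a \<le> d" "Suc a \<le> b'" "Suc a \<le> d'"
          using p(8,9) False by (auto simp: min_def split: if_splits)
        obtain u where u: "psum m u + psum m (Suc a) = psum m b + psum m d"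
          using m.Arf_index_exists gt by blast
        obtain u' where u': "psum m' u' + psum m' (Suc a) = psum m' b' + psum m' d'"
          using m'.Arf_index_exists gt by blast
        have uu: "min u l = min u' l"
          using less.hyps[OF _ gt u u'] p False by simp
        have ge: "Suc a \<le> u" "Suc a \<le> u'"
          using m.Arf_index_ge[OF u] m'.Arf_index_ge[OF u'] gt by auto
        have "Suc a \<le> sum_end m (Suc a)" "Suc a \<le> sum_end m' (Suc a)"
          using m.sum_end_gt[of "Suc a"] m'.sum_end_gt[of "Suc a"] by auto
        moreover have "psum m f + psum m (Suc a) = psum m u + psum m (sum_end m (Suc a))"
          using p(5) u m.psum_sum_end[of a] by linarith
        moreover have "psum m' f' + psum m' (Suc a) = psum m' u' + psum m' (sum_end m' (Suc a))"
          using p(6) u' m'.psum_sum_end[of a] unfolding aa by linarith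
        ultimately show ?thesis
          using less.hyps[of "Suc a" u "sum_end m (Suc a)" "Suc a" u' "sum_end m' (Suc a)" f f']
            ge uu s[of "Suc a"] False by simp
      qed
    qed
  qed
qed

section \<open>Characters, \<open>k_E\<close> and \<open>MIN_G\<close>\<close>

text \<open>Passing from \<open>j\<close> to \<open>j + 1\<close> loses the sums that end at
  \<open>j\<close> and gains the one expressing entry \<open>j\<close>, which always reaches
  \<open>j + 1\<close>.\<close>

lemma (in mult_seq) restriction_number_Suc:
  assumes "j \<ge> 1"
  shows "restriction_number m j + 1 = restriction_number m (Suc j) + card {q. 1 \<le> q \<and> sum_end m q = j}"
proof -
  let ?A = "{q. 1 \<le> q \<and> q < j \<and> Suc j \<le> sum_end m q}" and ?B = "{q. 1 \<le> q \<and> sum_end m q = j}"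
  have B: "?B = {q. 1 \<le> q \<and> q < j \<and> sum_end m q = j}" using sum_end_gt by force
  have fin: "finite ?A" "finite ?B" unfolding B by auto
  have "{q. 1 \<le> q \<and> q < j \<and> j \<le> sum_end m q} = ?A \<union> ?B" unfolding B by auto
  then have 1: "restriction_number m j = card ?A + card ?B"
    unfolding restriction_number_def using fin by (simp add: card_Un_disjoint disjoint_iff)
  have "{q. 1 \<le> q \<and> q < Suc j \<and> Suc j \<le> sum_end m q} = insert j ?A"
    using sum_end_gt[of j] assms by (auto simp: less_Suc_eq)
  then have "restriction_number m (Suc j) = card ?A + 1"
    unfolding restriction_number_def using fin by simp
  then show ?thesis using 1 by simp
qed

text \<open>The restriction number rises, by one, exactly when no sum is lost at \<open>j\<close>.
  Characters are thus the positive indices that can be forbidden without destroying the Arf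
  property.\<close>

lemma PChar_iff:
  assumes "multiplicity_sequence (E i)"
  shows "j \<in> PChar E i \<longleftrightarrow> 1 \<le> j \<and> j \<notin> sum_end (E i) ` {1..}"
proof -
  interpret mult_seq "E i" by standard fact
  let ?B = "{q. 1 \<le> q \<and> sum_end (E i) q = j}"
  \<comment> \<open>Finiteness matters because \<open>card\<close> of an infinite set is 0.\<close>
  have "finite ?B"
    by (rule finite_subset[of _ "{..j}"]) (use sum_end_gt in force)+
  then have "card ?B = 0 \<longleftrightarrow> j \<notin> sum_end (E i) ` {1..}" by auto
  moreover have "restriction_number (E i) j < restriction_number (E i) (j + 1) \<longleftrightarrow> card ?B = 0" if "1 \<le> j"
    using restriction_number_Suc[OF that] by simp linarith
  ultimately show ?thesis by (auto simp: PChar_def)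
qed

text \<open>Two different numbers have equal truncations at \<open>l\<close> exactly when both are
  at least \<open>l\<close>. In this form a bound on \<open>k_E\<close> looks like the gluing
  equations for indices.\<close>

lemma enat_le_k_E_iff:
  "enat l \<le> k_E E q r \<longleftrightarrow> (\<forall>k\<ge>1. min (sum_end (E q) k) l = min (sum_end (E r) k) l)"
proof -
  have "(s \<noteq> s' \<longrightarrow> l \<le> min s s') \<longleftrightarrow> min s l = min s' l" for s s' :: nat by linarith
  then show ?thesis unfolding k_E_def D_set_def le_INF_iff enat_ord_simps by blast
qed

lemma k_E_commute: "k_E E q r = k_E E r q"
proof -
  have "D_set E q r = D_set E r q" by (auto simp: D_set_def)
  then show ?thesis unfolding k_E_def by (simp add: min.commute)
qed

lemma MIN_le:
  assumes "p \<in> {1..t}" "j p q \<noteq> j p r"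
  shows "MIN_G E t j q r \<le> enat (min (j p q) (j p r))"
proof -
  have "Min {min (j p q) (j p r) | p. p \<in> {1..t} \<and> j p q \<noteq> j p r} \<le> min (j p q) (j p r)"
    using assms by (intro Min_le) auto
  then show ?thesis unfolding MIN_G_def by (meson enat_ord_simps(1) min.coboundedI2)
qed

section \<open>Arf semigroups of partial sums\<close>

lemma Arf_semigroupD:
  assumes "Arf_semigroup S"
  shows "0 \<in> S" "\<And>x y. x \<in> S \<Longrightarrow> y \<in> S \<Longrightarrow> vmin x y \<in> S"
    "\<And>x y i. \<lbrakk>x \<in> S; y \<in> S; x \<noteq> y; x $ i = y $ i\<rbrakk> \<Longrightarrow> \<exists>c\<in>S. c $ i > x $ i \<and>
       (\<forall>j. j \<noteq> i \<longrightarrow> c $ j \<ge> min (x $ j) (y $ j) \<and> (x $ j \<noteq> y $ j \<longrightarrow> c $ j = min (x $ j) (y $ j)))"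
  using assms unfolding Arf_semigroup_def good_semigroup_def submonoid_vec_def by blast+

lemma vmin_nth [simp]: "vmin x y $ i = min (x $ i) (y $ i)"
  by (simp add: vmin_def)

text \<open>The minimum \<open>u\<close> of all three elements lies in \<open>S\<close> below
  \<open>x\<close> and \<open>y\<close>, so \<open>x + y - u\<close> is available; it agrees with
  \<open>x + y - z\<close> wherever \<open>z\<close> is below both. Requiring this only
  coordinatewise lets later proofs ignore the other branches.\<close>

lemma Arf_combine:
  fixes S :: "(nat ^ 'n) set"
  assumes S: "Arf_semigroup S" and "x \<in> S" "y \<in> S" "z \<in> S"
  shows "\<exists>w\<in>S. \<forall>i. z $ i \<le> x $ i \<longrightarrow> z $ i \<le> y $ i \<longrightarrow> w $ i + z $ i = x $ i + y $ i"
proof -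
  define u where "u = vmin z (vmin x y)"
  have u: "u \<in> S" "u \<le> x" "u \<le> y"
    using assms by (auto simp: u_def Arf_semigroupD less_eq_vec_def)
  obtain w where w: "w \<in> S" "u \<le> w" "(x - u) + (y - u) = w - u"
    using S u assms(2,3) unfolding Arf_semigroup_def by blast
  have "w $ i + z $ i = x $ i + y $ i" if "z $ i \<le> x $ i" "z $ i \<le> y $ i" for i
  proof -
    have "u $ i = z $ i" using that by (simp add: u_def)
    moreover have "(x - u) $ i + (y - u) $ i = (w - u) $ i" using w(3) by (metis vector_add_component)
    moreover have "u $ i \<le> w $ i" using w(2) by (simp add: less_eq_vec_def)
    ultimately show ?thesis using that by simp
  qed
  with w(1) show ?thesis by blast
qed

text \<open>This is \<open>x + y - z\<close> with \<open>z\<close> the componentwise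
  minimum.\<close>

lemma Arf_max:
  fixes S :: "(nat ^ 'n) set"
  assumes "Arf_semigroup S" "x \<in> S" "y \<in> S"
  shows "(\<chi> i. max (x $ i) (y $ i)) \<in> S"
proof -
  obtain w where w: "w \<in> S" "\<And>i. w $ i + min (x $ i) (y $ i) = x $ i + y $ i"
    using Arf_combine[OF assms Arf_semigroupD(2)[OF assms]] by auto
  have "w $ i = max (x $ i) (y $ i)" for i using w(2)[of i] by (simp add: max_def min_def split: if_splits)
  then have "w = (\<chi> i. max (x $ i) (y $ i))" by (simp add: vec_eq_iff)
  with w(1) show ?thesis by simp
qed

text \<open>A triple \<open>(q, r, l)\<close> in \<open>C\<close> makes \<open>q\<close> and
  \<open>r\<close> behave as branches glued up to level \<open>l\<close>; \<open>F i\<close> holds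
  forbidden indices. Keeping both variable lets one proof of the Arf property serve
  \<open>S(T)\<close> and its modifications.\<close>

definition admissible :: "('n \<times> 'n \<times> nat) set \<Rightarrow> ('n \<Rightarrow> nat set) \<Rightarrow> ('n \<Rightarrow> nat) \<Rightarrow> bool" where
  "admissible C F j \<longleftrightarrow> (\<forall>(q, r, l)\<in>C. min (j q) l = min (j r) l) \<and> (\<forall>i. j i \<notin> F i)"

lemma admissibleI:
  assumes "\<And>q r l. (q, r, l) \<in> C \<Longrightarrow> min (j q) l = min (j r) l" "\<And>i. j i \<notin> F i"
  shows "admissible C F j"
  using assms by (auto simp: admissible_def)

lemma admissibleD:
  assumes "admissible C F j"
  shows "(q, r, l) \<in> C \<Longrightarrow> min (j q) l = min (j r) l" "j i \<notin> F i"
  using assms by (auto simp: admissible_def)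

text \<open>\<open>C_sum_end\<close> and \<open>F_sum_end\<close> give closure under
  \<open>x + y - z\<close>, \<open>F_0\<close> keeps the zero vector, \<open>C_one\<close> makes the
  semigroup local, and \<open>C_bdd\<close> and \<open>F_finite\<close> leave all large vectors in
  it. \<open>C_bdd\<close> excludes \<open>q = r\<close> since a branch is glued to itself at every
  level.\<close>

locale index_constraints =
  fixes E :: "'n::finite \<Rightarrow> nat \<Rightarrow> nat" and C :: "('n \<times> 'n \<times> nat) set" and F :: "'n \<Rightarrow> nat set"
  assumes mult_E: "\<And>i. multiplicity_sequence (E i)"
    and C_sum_end: "\<And>q r l k. (q, r, l) \<in> C \<Longrightarrow> k \<ge> 1 \<Longrightarrow> min (sum_end (E q) k) l = min (sum_end (E r) k) l"
    and C_one: "\<And>q r. (q, r, 1) \<in> C"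
    and C_bdd: "\<exists>L. \<forall>(q, r, l)\<in>C. q \<noteq> r \<longrightarrow> l \<le> L"
    and F_finite: "\<And>i. finite (F i)"
    and F_0: "\<And>i. 0 \<notin> F i"
    and F_sum_end: "\<And>i. F i \<inter> sum_end (E i) ` {1..} = {}"
begin

sublocale mult_seq "E i" for i by standard (rule mult_E)

lemma V_E_le_iff [simp]: "V_E E j \<le> V_E E j' \<longleftrightarrow> (\<forall>i. j i \<le> j' i)"
  by (simp add: less_eq_vec_def V_E_nth)

lemma V_E_inject [simp]: "V_E E j = V_E E j' \<longleftrightarrow> j = j'"
  by (auto simp: vec_eq_iff V_E_nth)

lemma admissible_0: "admissible C F (\<lambda>_. 0)"
  by (auto simp: admissible_def F_0)

text \<open>Componentwise the new index is an old one or the end of a sum, so it is not forbidden;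
  \<open>Arf_index_cong\<close> preserves the equations in \<open>C\<close>.\<close>

lemma admissible_combine:
  assumes "admissible C F a" "admissible C F b" "admissible C F d"
    and ab: "\<And>i. a i \<le> b i" and ad: "\<And>i. a i \<le> d i"
  obtains f where "admissible C F f" "V_E E f + V_E E a = V_E E b + V_E E d"
proof -
  have "\<forall>i. \<exists>f. psum (E i) f + psum (E i) (a i) = psum (E i) (b i) + psum (E i) (d i) \<and>
      (f = b i \<or> f = d i \<or> f \<in> sum_end (E i) ` {1..})"
    using Arf_index_exists ab ad by blast
  then obtain f where f: "\<And>i. psum (E i) (f i) + psum (E i) (a i) = psum (E i) (b i) + psum (E i) (d i)"
    "\<And>i. f i = b i \<or> f i = d i \<or> f i \<in> sum_end (E i) ` {1..}"
    by metis
  have "min (f q) l = min (f r) l" if "(q, r, l) \<in> C" for q r l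
    using assms that
    by (intro Arf_index_cong[OF mult_E mult_E C_sum_end[OF that] ab ad ab ad f(1) f(1)])
       (auto simp: admissible_def)
  moreover have "f i \<notin> F i" for i
    using f(2)[of i] F_sum_end[of i] assms(2,3) by (auto simp: admissible_def)
  ultimately have "admissible C F f" by (auto simp: admissible_def)
  moreover have "V_E E f + V_E E a = V_E E b + V_E E d" by (simp add: vec_eq_iff V_E_nth f(1))
  ultimately show ?thesis by (rule that)
qed

lemma large_index:
  obtains L where "\<And>q r l. (q, r, l) \<in> C \<Longrightarrow> q \<noteq> r \<Longrightarrow> l \<le> L" "\<And>i x. x \<in> F i \<Longrightarrow> x < L"
    "\<And>i l. l \<ge> L \<Longrightarrow> E i l = 1" "L \<ge> L0"
proof -
  obtain L1 where L1: "\<And>q r l. (q, r, l) \<in> C \<Longrightarrow> q \<noteq> r \<Longrightarrow> l \<le> L1" using C_bdd by blast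
  have "\<forall>i. \<exists>L. \<forall>l\<ge>L. E i l = 1" using mult_E by (auto simp: multiplicity_sequence_def)
  then obtain L2 where L2: "\<And>i l. l \<ge> L2 i \<Longrightarrow> E i l = 1" by metis
  have "finite (\<Union>i. F i)" using F_finite by auto
  then obtain L3 where L3: "\<And>i x. x \<in> F i \<Longrightarrow> x < L3"
    using finite_nat_set_iff_bounded by (metis UNIV_I UN_I)
  define L where "L = Max {L0, L1, L3, Max (range L2)}"
  have L: "L0 \<le> L" "L1 \<le> L" "L3 \<le> L" "Max (range L2) \<le> L" unfolding L_def by (intro Max_ge; simp)+
  have "L2 i \<le> L" for i
    by (rule le_trans[OF _ L(4)]) simp
  show ?thesis
  proof (rule that[of L])
    show "l \<le> L" if "(q, r, l) \<in> C" "q \<noteq> r" for q r l using L1[OF that] L(2) by simp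
    show "x < L" if "x \<in> F i" for i x using L3[OF that] L(3) by simp
    show "E i l = 1" if "l \<ge> L" for i l using L2 \<open>L2 i \<le> L\<close> that by (meson le_trans)
    show "L \<ge> L0" by (rule L(1))
  qed
qed

definition semigroup_of :: "(nat ^ 'n) set" where
  "semigroup_of = {V_E E j | j. admissible C F j}"

lemma semigroup_of_combine:
  assumes "x \<in> semigroup_of" "y \<in> semigroup_of" "z \<in> semigroup_of" "z \<le> x" "z \<le> y"
  obtains w where "w \<in> semigroup_of" "w + z = x + y"
proof -
  obtain a b d where "x = V_E E b" "admissible C F b" "y = V_E E d" "admissible C F d"
    "z = V_E E a" "admissible C F a"
    using assms(1-3) unfolding semigroup_of_def by blast
  moreover from this obtain f where "admissible C F f" "V_E E f + V_E E a = V_E E b + V_E E d"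
    using assms(4,5) by (auto intro: admissible_combine)
  ultimately show ?thesis using that[of "V_E E f"] by (auto simp: semigroup_of_def)
qed

lemma Arf_semigroup_of: "Arf_semigroup semigroup_of"
proof -
  have V0: "V_E E (\<lambda>_. 0) = 0" by (simp add: vec_eq_iff V_E_nth)
  have zero: "0 \<in> semigroup_of" unfolding semigroup_of_def using V0 admissible_0 by force
  have add: "x + y \<in> semigroup_of" if "x \<in> semigroup_of" "y \<in> semigroup_of" for x y
    using semigroup_of_combine[OF that zero] by (auto simp: less_eq_vec_def)
  have vm: "vmin x y \<in> semigroup_of" if xy: "x \<in> semigroup_of" "y \<in> semigroup_of" for x y
  proof -
    obtain a b where ab: "x = V_E E a" "admissible C F a" "y = V_E E b" "admissible C F b"
      using xy unfolding semigroup_of_def by blast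
    have vm: "vmin x y = V_E E (\<lambda>i. min (a i) (b i))"
      by (simp add: vec_eq_iff V_E_nth ab(1,3) min_of_mono[OF strict_mono_mono[OF psum_strict_mono]])
    have "min (min (a q) (b q)) l = min (min (a r) (b r)) l" if "(q, r, l) \<in> C" for q r l
    proof -
      have "min (a q) l = min (a r) l" "min (b q) l = min (b r) l"
        using ab(2,4) that by (auto simp: admissible_def)
      then show ?thesis by linarith
    qed
    moreover have "min (a i) (b i) \<notin> F i" for i
      using admissibleD(2)[OF ab(2)] admissibleD(2)[OF ab(4)] by (simp add: min_def)
    ultimately have "admissible C F (\<lambda>i. min (a i) (b i))" by (intro admissibleI)
    then show ?thesis using vm unfolding semigroup_of_def by blast
  qed
  have swap: "\<exists>c\<in>semigroup_of. c $ i > x $ i \<and>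
       (\<forall>j. j \<noteq> i \<longrightarrow> c $ j \<ge> min (x $ j) (y $ j) \<and> (x $ j \<noteq> y $ j \<longrightarrow> c $ j = min (x $ j) (y $ j)))"
    if xy: "x \<in> semigroup_of" "y \<in> semigroup_of" and i: "x $ i = y $ i" for x y i
  proof -
    obtain a b where ab: "x = V_E E a" "admissible C F a" "y = V_E E b" "admissible C F b"
      using xy unfolding semigroup_of_def by blast
    obtain L where L: "\<And>q r l. (q, r, l) \<in> C \<Longrightarrow> q \<noteq> r \<Longrightarrow> l \<le> L" "\<And>i x. x \<in> F i \<Longrightarrow> x < L"
      and L0: "L \<ge> Max (range a) + 1"
      by (rule large_index[where ?L0.0 = "Max (range a) + 1"]) blast
    have "a h \<le> Max (range a)" for h by simp
    then have aL: "a h < L" for h using L0 by (metis Suc_eq_plus1 le_imp_less_Suc less_le_trans)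
    have bL: "a h = b h \<Longrightarrow> b h < L" for h using aL[of h] by simp
    \<comment> \<open>Where the indices agree, \<open>c\<close> jumps to \<open>L\<close>. If they
      agree at only one of two coordinates constrained at level \<open>l\<close>, both indices at
      the other are at least \<open>l\<close>, and so is \<open>L\<close>.\<close>
    define c where "c h = (if a h = b h then L else min (a h) (b h))" for h
    have "min (c q) l = min (c r) l" if qr: "(q, r, l) \<in> C" for q r l
    proof (cases "q = r")
      case False
      have "min (a q) l = min (a r) l" "min (b q) l = min (b r) l" "l \<le> L"
        using ab(2,4) qr L(1)[OF qr False] by (auto simp: admissible_def)
      then show ?thesis unfolding c_def by (auto simp: min_def split: if_splits)
    qed simp
    moreover have "c h \<notin> F h" for h
      using ab(2,4) L(2) unfolding c_def admissible_def by (auto simp: min_def)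
    ultimately have "admissible C F c" by (auto simp: admissible_def)
    then have "V_E E c \<in> semigroup_of" by (auto simp: semigroup_of_def)
    moreover have "a i = b i" using i ab by (simp add: V_E_nth)
    moreover have "min (psum (E h) (a h)) (psum (E h) (b h)) = psum (E h) (min (a h) (b h))" for h
      by (simp add: min_of_mono[OF strict_mono_mono[OF psum_strict_mono]])
    ultimately show ?thesis
      using bL by (intro bexI[of _ "V_E E c"]) (auto simp: ab V_E_nth c_def less_imp_le)
  qed
  have cond: "\<exists>\<delta>\<in>semigroup_of. \<forall>v. \<delta> + v \<in> semigroup_of"
  proof -
    obtain L where L: "\<And>q r l. (q, r, l) \<in> C \<Longrightarrow> q \<noteq> r \<Longrightarrow> l \<le> L" "\<And>i x. x \<in> F i \<Longrightarrow> x < L"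
      "\<And>i l. l \<ge> L \<Longrightarrow> E i l = 1"
      by (rule large_index) blast
    have *: "V_E E (\<lambda>_. L) + v \<in> semigroup_of" for v
    proof -
      have "V_E E (\<lambda>_. L) + v = V_E E (\<lambda>i. L + v $ i)"
        by (simp add: vec_eq_iff V_E_nth psum_eventually[OF L(3)])
      moreover have "min (L + v $ q) l = min (L + v $ r) l" if "(q, r, l) \<in> C" for q r l
        using L(1)[OF that] by (cases "q = r") auto
      then have "admissible C F (\<lambda>i. L + v $ i)"
        using L(2) by (intro admissibleI) force+
      ultimately show ?thesis by (auto simp: semigroup_of_def)
    qed
    from *[of 0] * show ?thesis by auto
  qed
  have loc: "local_semigroup semigroup_of"
    unfolding local_semigroup_def
  proof (intro ballI impI)
    fix x assume "x \<in> semigroup_of" "\<exists>i. x $ i = 0"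
    then obtain a i where a: "x = V_E E a" "admissible C F a" "psum (E i) (a i) = 0"
      by (auto simp: semigroup_of_def V_E_nth)
    have "a i = 0" using le_psum[of "a i" i] a(3) by simp
    then have "a h = 0" for h
      using a(2) C_one[of h i] unfolding admissible_def by (fastforce simp: min_def split: if_splits)
    then show "x = 0" using a(1) by (simp add: vec_eq_iff V_E_nth)
  qed
  have arf: "u + v \<in> {\<beta> - \<alpha> |\<beta>. \<beta> \<in> semigroup_of \<and> \<alpha> \<le> \<beta>}"
    if \<alpha>: "\<alpha> \<in> semigroup_of" and "u \<in> {\<beta> - \<alpha> |\<beta>. \<beta> \<in> semigroup_of \<and> \<alpha> \<le> \<beta>}"
      "v \<in> {\<beta> - \<alpha> |\<beta>. \<beta> \<in> semigroup_of \<and> \<alpha> \<le> \<beta>}" for \<alpha> u v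
  proof -
    obtain x y where xy: "x \<in> semigroup_of" "\<alpha> \<le> x" "u = x - \<alpha>" "y \<in> semigroup_of" "\<alpha> \<le> y" "v = y - \<alpha>"
      using \<open>u \<in> _\<close> \<open>v \<in> _\<close> by auto
    obtain w where w: "w \<in> semigroup_of" "w + \<alpha> = x + y"
      by (rule semigroup_of_combine[OF xy(1,4) \<alpha> xy(2,5)])
    have "\<alpha> $ i \<le> x $ i \<and> \<alpha> $ i \<le> y $ i \<and> w $ i + \<alpha> $ i = x $ i + y $ i" for i
      using xy(2,5) w(2) by (metis less_eq_vec_def vector_add_component)
    moreover have aux: "a \<le> w \<and> (x - a) + (y - a) = w - a"
      if "a \<le> x \<and> a \<le> y \<and> w + a = x + y" for a x y w :: nat using that by linarith
    ultimately have "\<alpha> $ i \<le> w $ i \<and> (u + v) $ i = (w - \<alpha>) $ i" for i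
      unfolding xy(3,6) vector_add_component vector_minus_component
      by (intro aux) blast
    then have "\<alpha> \<le> w" "u + v = w - \<alpha>" by (auto simp: less_eq_vec_def vec_eq_iff)
    then show ?thesis using w(1) by blast
  qed
  show ?thesis
    unfolding Arf_semigroup_def good_semigroup_def submonoid_vec_def
    by (intro conjI ballI allI impI; (elim conjE)?)
      (fact zero | erule (1) add | erule (1) vm | erule (2) swap | fact cond | fact loc | erule (2) arf)+
qed

end

section \<open>Elements forced by the generators\<close>

text \<open>Replacing \<open>w\<close> by \<open>x + w - y\<close> keeps the entry at
  \<open>q\<close> and raises the one at \<open>r\<close> by \<open>x $ r - y $ r\<close>; this can
  be repeated.\<close>

lemma Arf_unbounded:
  fixes S :: "(nat ^ 'n) set"
  assumes "Arf_semigroup S" "x \<in> S" "y \<in> S" "x $ q = y $ q" "y $ r < x $ r"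
  shows "\<exists>w\<in>S. w $ q = y $ q \<and> N \<le> w $ r"
proof -
  \<comment> \<open>The offset \<open>y $ r\<close> keeps \<open>w\<close> above \<open>y\<close> at
    \<open>r\<close>, as \<open>Arf_combine\<close> requires.\<close>
  have "\<exists>w\<in>S. w $ q = y $ q \<and> y $ r + N \<le> w $ r"
  proof (induction N)
    case 0
    then show ?case using assms(3) by auto
  next
    case (Suc N)
    then obtain w where w: "w \<in> S" "w $ q = y $ q" "y $ r + N \<le> w $ r" by blast
    obtain v where v: "v \<in> S" "\<forall>i. y $ i \<le> x $ i \<longrightarrow> y $ i \<le> w $ i \<longrightarrow> v $ i + y $ i = x $ i + w $ i"
      using Arf_combine[OF assms(1,2) w(1) assms(3)] by blast
    have "v $ q = y $ q" using v(2)[rule_format, of q] w(2) assms(4) by simp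
    moreover have "y $ r + Suc N \<le> v $ r" using v(2)[rule_format, of r] w(3) assms(5) by simp
    ultimately show ?case using v(1) by blast
  qed
  then show ?thesis by (meson le_add2 le_trans)
qed

text \<open>The exchange property at \<open>q\<close> raises that entry and takes the smaller value
  at \<open>r\<close>, where \<open>x\<close> and \<open>y\<close> differ. An excess at
  \<open>r\<close> is thus traded for one at \<open>q\<close>.\<close>

lemma Arf_swap:
  fixes S :: "(nat ^ 'n) set"
  assumes "Arf_semigroup S" "x \<in> S" "y \<in> S" "x $ q = y $ q" "y $ r < x $ r"
  shows "\<exists>c\<in>S. c $ r = y $ r \<and> y $ q < c $ q"
proof -
  have "x \<noteq> y" "r \<noteq> q" using assms by auto
  then obtain c where c: "c \<in> S" "x $ q < c $ q" "x $ r \<noteq> y $ r \<longrightarrow> c $ r = min (x $ r) (y $ r)"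
    using Arf_semigroupD(3)[OF assms(1-3) _ assms(4)] by blast
  then show ?thesis using assms(4,5) by (intro bexI[of _ c]) auto
qed

lemma Arf_join:
  fixes S :: "(nat ^ 'n) set"
  assumes "Arf_semigroup S" "finite A" "A \<noteq> {}"
    and "\<And>r. r \<in> A \<Longrightarrow> \<exists>w\<in>S. w $ q = v \<and> f r \<le> w $ r"
  shows "\<exists>w\<in>S. w $ q = v \<and> (\<forall>r\<in>A. f r \<le> w $ r)"
  using assms(2-)
proof (induction rule: finite_ne_induct)
  case (singleton r)
  then show ?case by auto
next
  case (insert r A)
  then obtain x where x: "x \<in> S" "x $ q = v" "\<forall>r\<in>A. f r \<le> x $ r" by blast
  obtain y where y: "y \<in> S" "y $ q = v" "f r \<le> y $ r" using insert.prems by blast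
  show ?case
    using Arf_max[OF assms(1) x(1) y(1)] x y
    by (intro bexI[of _ "\<chi> i. max (x $ i) (y $ i)"]) (auto simp: le_max_iff_disj)
qed

lemma Arf_meet:
  fixes S :: "(nat ^ 'n) set"
  assumes "Arf_semigroup S" "finite A" "A \<noteq> {}"
    and "\<And>q. q \<in> A \<Longrightarrow> \<exists>w\<in>S. w $ q = f q \<and> (\<forall>r. f r \<le> w $ r)"
  shows "\<exists>w\<in>S. (\<forall>q\<in>A. w $ q = f q) \<and> (\<forall>r. f r \<le> w $ r)"
  using assms(2-)
proof (induction rule: finite_ne_induct)
  case (singleton r)
  then show ?case by auto
next
  case (insert q A)
  then obtain x where x: "x \<in> S" "\<forall>q\<in>A. x $ q = f q" "\<forall>r. f r \<le> x $ r" by blast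
  obtain y where y: "y \<in> S" "y $ q = f q" "\<forall>r. f r \<le> y $ r" using insert.prems by blast
  show ?case
    using Arf_semigroupD(2)[OF assms(1) x(1) y(1)] x y
    by (intro bexI[of _ "vmin x y"]) (auto simp: min_absorb1 min_absorb2)
qed

text \<open>For fixed \<open>q\<close>, maxima over \<open>r\<close> give an element with the right
  entry at \<open>q\<close> that is at least \<open>x\<close> everywhere; the minimum of these over
  all \<open>q\<close> is \<open>x\<close>.\<close>

lemma Arf_mem_pairwise:
  fixes S :: "(nat ^ 'n::finite) set"
  assumes "Arf_semigroup S" and "\<And>q r. \<exists>w\<in>S. w $ q = x $ q \<and> x $ r \<le> w $ r"
  shows "x \<in> S"
proof -
  have "\<exists>w\<in>S. w $ q = x $ q \<and> (\<forall>r. x $ r \<le> w $ r)" for q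
    using Arf_join[of S UNIV q "x $ q" "($) x"] assms by simp
  then obtain w where "w \<in> S" "\<forall>q. w $ q = x $ q"
    using Arf_meet[of S UNIV "($) x"] assms(1) by auto
  then show ?thesis by (metis vec_eq_iff)
qed

section \<open>Pairs of levels attained in an arbitrary Arf semigroup containing the
  generators\<close>

locale Arf_generators =
  fixes E :: "'n::finite \<Rightarrow> nat \<Rightarrow> nat" and S :: "(nat ^ 'n) set" and J :: "('n \<Rightarrow> nat) set"
  assumes mult_E: "\<And>i. multiplicity_sequence (E i)"
    and Arf_S: "Arf_semigroup S"
    and J_S: "\<And>j. j \<in> J \<Longrightarrow> V_E E j \<in> S"
    and J_PChar: "\<And>i. PChar E i \<subseteq> (\<lambda>j. j i) ` J"
begin

sublocale mult_seq "E i" for i by standard (rule mult_E)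

definition attains :: "'n \<Rightarrow> 'n \<Rightarrow> nat \<Rightarrow> nat \<Rightarrow> bool" where
  "attains q r a b \<longleftrightarrow> (\<exists>w\<in>S. w $ q = psum (E q) a \<and> w $ r = psum (E r) b)"

text \<open>Doubling the element at \<open>Suc c\<close> and subtracting the one at \<open>c\<close>
  reaches, by \<open>psum_sum_end\<close>, the ends of both sums at once.\<close>

lemma attains_sum_end:
  assumes "attains q r c c" "attains q r (Suc c) (Suc c)"
  shows "attains q r (sum_end (E q) (Suc c)) (sum_end (E r) (Suc c))"
proof -
  obtain z x where z: "z \<in> S" "z $ q = psum (E q) c" "z $ r = psum (E r) c"
    and x: "x \<in> S" "x $ q = psum (E q) (Suc c)" "x $ r = psum (E r) (Suc c)"
    using assms by (auto simp: attains_def)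
  obtain w where w: "w \<in> S" "\<forall>i. z $ i \<le> x $ i \<longrightarrow> w $ i + z $ i = x $ i + x $ i"
    using Arf_combine[OF Arf_S x(1) x(1) z(1)] by blast
  have "w $ q = psum (E q) (sum_end (E q) (Suc c))"
    using w(2)[rule_format, of q] x(2) z(2) psum_sum_end[of q c] by simp
  moreover have "w $ r = psum (E r) (sum_end (E r) (Suc c))"
    using w(2)[rule_format, of r] x(3) z(3) psum_sum_end[of r c] by simp
  ultimately show ?thesis using w(1) by (auto simp: attains_def)
qed

text \<open>The index \<open>a\<close> is 0, a character, or the end of an earlier sum. A character
  comes with a generator; an end is reached from two smaller diagonal levels. Agreement below
  \<open>p\<close> makes the index on \<open>r\<close> at least \<open>a\<close>.\<close>

lemma attains_half:
  assumes s: "\<And>k. k \<ge> 1 \<Longrightarrow> min (sum_end (E q) k) p = min (sum_end (E r) k) p"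
    and J: "\<And>j. j \<in> J \<Longrightarrow> min (j q) p = min (j r) p"
    and "a \<le> p" and IH: "\<And>b. b < a \<Longrightarrow> attains q r b b"
  shows "\<exists>b\<ge>a. attains q r a b"
proof -
  consider "a = 0" | "a \<in> PChar E q" | k where "k \<ge> 1" "a = sum_end (E q) k"
    using PChar_iff[of E q a] mult_E by force
  then show ?thesis
  proof cases
    case 1
    have "attains q r 0 0"
      unfolding attains_def by (intro bexI[of _ 0]) (simp_all add: Arf_semigroupD(1)[OF Arf_S])
    then show ?thesis using 1 by auto
  next
    case 2
    then obtain j where j: "j \<in> J" "j q = a" using J_PChar by blast
    have "a \<le> j r" using J[OF j(1)] j(2) \<open>a \<le> p\<close> by linarith
    moreover have "attains q r a (j r)"
      using J_S[OF j(1)] j(2) by (auto simp: attains_def V_E_nth intro!: bexI[of _ "V_E E j"])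
    ultimately show ?thesis by blast
  next
    case 3
    then obtain c where c: "k = Suc c" by (cases k) auto
    have "Suc c < a" using 3 sum_end_gt[of k q] c by simp
    then have "attains q r a (sum_end (E r) k)"
      using attains_sum_end[of q r c] IH 3(2) c by simp
    moreover have "a \<le> sum_end (E r) k" using s[OF 3(1)] 3(2) \<open>a \<le> p\<close> by linarith
    ultimately show ?thesis by blast
  qed
qed

lemma attains_sym: "attains q r a b \<longleftrightarrow> attains r q b a"
  by (auto simp: attains_def)

text \<open>The minimum of the elements that \<open>attains_half\<close> gives for
  \<open>(q, r)\<close> and \<open>(r, q)\<close> has both indices exactly \<open>a\<close>.\<close>

lemma attains_diagonal:
  assumes s: "\<And>k. k \<ge> 1 \<Longrightarrow> min (sum_end (E q) k) p = min (sum_end (E r) k) p"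
    and J: "\<And>j. j \<in> J \<Longrightarrow> min (j q) p = min (j r) p"
    and "a \<le> p"
  shows "attains q r a a"
  using \<open>a \<le> p\<close>
proof (induction a rule: less_induct)
  case (less a)
  have IH: "attains q r b b" if "b < a" for b using less that by simp
  obtain b where b: "b \<ge> a" "attains q r a b" using attains_half[OF s J less.prems IH] by blast
  obtain c where c: "c \<ge> a" "attains r q a c"
    using attains_half[of r p q a] s J less.prems IH attains_sym by metis
  obtain x y where x: "x \<in> S" "x $ q = psum (E q) a" "x $ r = psum (E r) b"
    and y: "y \<in> S" "y $ r = psum (E r) a" "y $ q = psum (E q) c"
    using b(2) c(2) by (auto simp: attains_def)
  have "vmin x y $ q = psum (E q) a" "vmin x y $ r = psum (E r) a"
    using x y b(1) c(1) by (simp_all add: min_absorb1 min_absorb2)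
  then show ?case using Arf_semigroupD(2)[OF Arf_S x(1) y(1)] unfolding attains_def by blast
qed

text \<open>For \<open>q = r\<close> the hypotheses of \<open>attains_diagonal\<close> are trivial
  at every level.\<close>

lemma projection: "\<exists>w\<in>S. w $ q = psum (E q) a"
  using attains_diagonal[of q a q a] by (auto simp: attains_def)

text \<open>The separating element is compared with the diagonal one at \<open>p\<close>. An excess
  on \<open>r\<close> can be used directly; an excess on \<open>q\<close> is moved to
  \<open>r\<close> by \<open>Arf_swap\<close>. Then \<open>Arf_unbounded\<close> applies.\<close>

lemma separation:
  assumes "attains q r p p" and "attains q r u v" "u \<noteq> v" "min u v = p"
  shows "\<exists>w\<in>S. w $ q = psum (E q) p \<and> N \<le> w $ r"
proof -
  obtain y where y: "y \<in> S" "y $ q = psum (E q) p" "y $ r = psum (E r) p"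
    using assms(1) by (auto simp: attains_def)
  obtain x where x: "x \<in> S" "x $ q = psum (E q) u" "x $ r = psum (E r) v"
    using assms(2) by (auto simp: attains_def)
  obtain c where c: "c \<in> S" "c $ q = y $ q" "y $ r < c $ r"
  proof (cases "u < v")
    case True
    then show ?thesis using that[of x] x y assms(4) by simp
  next
    case False
    then have "x $ r = y $ r" "y $ q < x $ q" using x y assms(3,4) by auto
    then show ?thesis using Arf_swap[OF Arf_S x(1) y(1)] that by blast
  qed
  then show ?thesis using Arf_unbounded[OF Arf_S c(1) y(1) c(2,3)] y(2) by simp
qed

lemma separation_above:
  assumes "attains q r p p" and "attains q r u v" "u \<noteq> v" "min u v = p" and "p \<le> a"
  shows "\<exists>w\<in>S. w $ q = psum (E q) a \<and> N \<le> w $ r"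
proof -
  obtain x where x: "x \<in> S" "x $ q = psum (E q) p" "N \<le> x $ r" using separation[OF assms(1-4)] by blast
  obtain y where y: "y \<in> S" "y $ q = psum (E q) a" using projection by blast
  show ?thesis
    using Arf_max[OF Arf_S x(1) y(1)] x y \<open>p \<le> a\<close>
    by (intro bexI[of _ "\<chi> i. max (x $ i) (y $ i)"]) (auto simp: max_absorb2 le_max_iff_disj)
qed

text \<open>By \<open>sep\<close>, a generator or a pair of sum ends separates \<open>q\<close> and
  \<open>r\<close> exactly at \<open>p q r\<close>. Below that level diagonal elements suffice; from
  there on the entry at \<open>r\<close> can be made arbitrarily large.\<close>

lemma V_E_mem:
  assumes s: "\<And>q r k. q \<noteq> r \<Longrightarrow> k \<ge> 1 \<Longrightarrow> min (sum_end (E q) k) (p q r) = min (sum_end (E r) k) (p q r)"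
    and J: "\<And>q r j. q \<noteq> r \<Longrightarrow> j \<in> J \<Longrightarrow> min (j q) (p q r) = min (j r) (p q r)"
    and sep: "\<And>q r. q \<noteq> r \<Longrightarrow> (\<exists>j\<in>J. j q \<noteq> j r \<and> min (j q) (j r) = p q r) \<or>
      (\<exists>k\<ge>1. sum_end (E q) k \<noteq> sum_end (E r) k \<and> min (sum_end (E q) k) (sum_end (E r) k) = p q r)"
    and j: "\<And>q r. q \<noteq> r \<Longrightarrow> min (j q) (p q r) = min (j r) (p q r)"
  shows "V_E E j \<in> S"
proof (rule Arf_mem_pairwise[OF Arf_S])
  fix q r
  show "\<exists>w\<in>S. w $ q = V_E E j $ q \<and> V_E E j $ r \<le> w $ r"
  proof (cases "q = r")
    case True
    then show ?thesis using projection by (metis V_E_nth order_refl)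
  next
    case qr: False
    have diag: "attains q r a a" if "a \<le> p q r" for a
      using attains_diagonal[of q "p q r" r a] s[OF qr] J[OF qr] that by blast
    show ?thesis
    proof (cases "j q < p q r")
      case True
      then have "j r = j q" using j[OF qr] by linarith
      then show ?thesis using diag[of "j q"] True by (auto simp: attains_def V_E_nth)
    next
      case False
      have "\<exists>u v. attains q r u v \<and> u \<noteq> v \<and> min u v = p q r"
        using sep[OF qr]
      proof (elim disjE bexE exE conjE)
        fix i assume "i \<in> J" "i q \<noteq> i r" "min (i q) (i r) = p q r"
        moreover have "attains q r (i q) (i r)"
          using J_S[OF \<open>i \<in> J\<close>] by (auto simp: attains_def V_E_nth intro!: bexI[of _ "V_E E i"])
        ultimately show ?thesis by blast
      next
        fix k assume k: "1 \<le> k" "sum_end (E q) k \<noteq> sum_end (E r) k"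
          "min (sum_end (E q) k) (sum_end (E r) k) = p q r"
        then obtain c where c: "k = Suc c" by (cases k) auto
        \<comment> \<open>Since \<open>k\<close> precedes both ends, it is at most
          \<open>p q r\<close>, and the diagonal levels \<open>k - 1\<close> and \<open>k\<close>
          are available.\<close>
        have "k \<le> p q r" using k(1,3) sum_end_gt[of k q] sum_end_gt[of k r] by simp
        then have "attains q r (sum_end (E q) k) (sum_end (E r) k)"
          unfolding c by (intro attains_sum_end diag) auto
        then show ?thesis using k by blast
      qed
      then show ?thesis
        using separation_above[OF diag[OF order_refl]] False by (auto simp: V_E_nth)
    qed
  qed
qed

end

section \<open>The semigroup of a tree\<close>

lemma min_eq_min_iff:
  fixes a b l :: nat
  shows "min a l = min b l \<longleftrightarrow> (\<forall>x\<le>l. x \<le> a \<longleftrightarrow> x \<le> b)"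
proof
  assume "min a l = min b l"
  then show "\<forall>x\<le>l. x \<le> a \<longleftrightarrow> x \<le> b" by (metis min.bounded_iff)
next
  assume H: "\<forall>x\<le>l. x \<le> a \<longleftrightarrow> x \<le> b"
  have "min a l \<le> b" "min b l \<le> a"
    using H[rule_format, of "min a l"] H[rule_format, of "min b l"] by simp_all
  then show "min a l = min b l" by linarith
qed

locale multiplicity_tree =
  fixes E :: "'n::{finite,linorder} \<Rightarrow> nat \<Rightarrow> nat" and T :: "('n, 'v) ltree"
  assumes mult_E: "\<And>i. multiplicity_sequence (E i)" and T_tau: "T \<in> tau E"
begin

sublocale mult_seq "E i" for i by standard (rule mult_E)

lemma node_level: "1 \<le> l \<Longrightarrow> 1 \<le> l' \<Longrightarrow> node T i l = node T j l' \<Longrightarrow> l = l'"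
  using T_tau unfolding tau_def mem_Collect_eq by blast

lemma glued_le: "1 \<le> l' \<Longrightarrow> l' \<le> l \<Longrightarrow> glued T i j l \<Longrightarrow> glued T i j l'"
  using T_tau unfolding tau_def mem_Collect_eq by blast

lemma glued_1: "glued T i j 1"
  using T_tau unfolding tau_def mem_Collect_eq by blast

lemma glued_refl [simp]: "glued T i i l"
  by (simp add: glued_def)

lemma glued_sym: "glued T i j l \<longleftrightarrow> glued T j i l"
  by (auto simp: glued_def)

lemma node_in_branch_iff: "1 \<le> l \<Longrightarrow> node T i l \<in> branch T h \<longleftrightarrow> glued T i h l"
  unfolding branch_def glued_def using node_level by auto

lemma lab_nth:
  assumes "1 \<le> l"
  shows "lab T (node T i l) $ h = (if glued T i h l then E h l else 0)"
proof -
  have "lab T (node T h l) $ h = E h l" "lab T (node T i l) $ h = 0 \<longleftrightarrow> node T i l \<notin> branch T h"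
    using T_tau assms unfolding tau_def mem_Collect_eq by blast+
  then show ?thesis using node_in_branch_iff[OF assms] by (auto simp: glued_def)
qed

text \<open>Nodes off branch \<open>h\<close> have entry 0 at \<open>h\<close>; those on it are
  distinct at distinct levels and have entry \<open>E h k\<close>.\<close>

lemma sum_lab_nth:
  assumes U: "finite U" "U \<subseteq> nodes T"
  shows "(\<Sum>x\<in>U. lab T x) $ h = (\<Sum>k | 1 \<le> k \<and> node T h k \<in> U. E h k)"
proof -
  let ?K = "{k. 1 \<le> k \<and> node T h k \<in> U}"
  have inj: "inj_on (node T h) ?K" using node_level by (auto intro!: inj_onI)
  have "(\<Sum>x\<in>U. lab T x) $ h = (\<Sum>x\<in>U. lab T x $ h)" by simp
  also have "\<dots> = (\<Sum>x\<in>node T h ` ?K. lab T x $ h)"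
  proof (intro sum.mono_neutral_right ballI)
    fix x assume x: "x \<in> U - node T h ` ?K"
    then obtain i l where il: "x = node T i l" "1 \<le> l" using U by (auto simp: nodes_def)
    then have "\<not> glued T i h l" using x by (auto simp: glued_def)
    then show "lab T x $ h = 0" using il by (simp add: lab_nth)
  qed (use U in auto)
  also have "\<dots> = (\<Sum>k\<in>?K. lab T (node T h k) $ h)" by (subst sum.reindex[OF inj]) simp
  also have "\<dots> = (\<Sum>k\<in>?K. E h k)" by (intro sum.cong) (auto simp: lab_nth)
  finally show ?thesis .
qed

text \<open>Edges of the path from the root may be given through other branches, but gluing passes
  to lower levels, so a path ending on branch \<open>h\<close> runs along it.\<close>

lemma finite_subtree_downward:
  assumes U: "finite_subtree T (node T i l) U" and "1 \<le> l" and "node T h k \<in> U" "1 \<le> k"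
  shows "l \<le> k \<and> (\<forall>k'\<in>{l..k}. node T h k' \<in> U)"
proof -
  have "(node T i l, node T h k) \<in> (edges T \<inter> U \<times> U)\<^sup>*" "node T i l \<in> U"
    using U assms(3) by (auto simp: finite_subtree_def)
  then show ?thesis using \<open>1 \<le> k\<close>
  proof (induction "node T h k" arbitrary: h k rule: rtrancl_induct)
    case base
    then have "k = l" using node_level[OF \<open>1 \<le> l\<close>] by blast
    then show ?case using base by simp
  next
    case (step y)
    then obtain g c where g: "1 \<le> c" "y = node T g c" "node T h k = node T g (Suc c)" "node T h k \<in> U"
      by (auto simp: edges_def)
    have k: "k = Suc c" using node_level[OF step.prems(2) _ g(3)] by simp
    have "glued T g h c" using g k by (intro glued_le[of c "Suc c"]) (auto simp: glued_def)
    then have "y = node T h c" using g(2) by (simp add: glued_def)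
    then have "l \<le> c" "\<forall>k'\<in>{l..c}. node T h k' \<in> U" using step.hyps(3) step.prems(1) g(1) by blast+
    then show ?case using g(4) k by (auto simp: le_Suc_eq)
  qed
qed

lemma finite_subtree_levels:
  assumes U: "finite_subtree T (node T i l) U" and "1 \<le> l" "glued T i h l"
  shows "\<exists>L\<ge>l. {k. 1 \<le> k \<and> node T h k \<in> U} = {l..L}"
proof -
  define K where "K = {k. 1 \<le> k \<and> node T h k \<in> U}"
  have mem: "k \<in> K \<longleftrightarrow> 1 \<le> k \<and> node T h k \<in> U" for k by (simp add: K_def)
  have "inj_on (node T h) K" using node_level by (auto simp: mem intro!: inj_onI)
  moreover have "finite (node T h ` K)"
    by (rule finite_subset[of _ U]) (use U in \<open>auto simp: mem finite_subtree_def\<close>)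
  ultimately have fin: "finite K" by (rule finite_imageD[rotated])
  have l: "l \<in> K" using assms by (auto simp: mem finite_subtree_def glued_def)
  have "Max K \<in> K" using fin l by (intro Max_in) auto
  then have "k \<in> K" if "k \<in> {l..Max K}" for k
    using finite_subtree_downward[OF U \<open>1 \<le> l\<close>, of h "Max K"] that \<open>1 \<le> l\<close> by (simp add: mem)
  moreover have "k \<in> {l..Max K}" if "k \<in> K" for k
    using finite_subtree_downward[OF U \<open>1 \<le> l\<close>, of h k] that fin by (simp add: mem)
  ultimately have "K = {l..Max K}" by blast
  moreover have "l \<le> Max K" using fin l by simp
  ultimately show ?thesis unfolding K_def by blast
qed

text \<open>The subtree expressing the label at level \<open>k\<close>, read in coordinate
  \<open>h\<close>, meets branch \<open>h\<close> from \<open>k\<close> to the end of the sum for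
  \<open>k\<close>. Up to level \<open>l\<close> the branches \<open>q\<close> and \<open>r\<close>
  share their nodes, so ends that differ are both at least \<open>l\<close>.\<close>

lemma min_sum_end_glued:
  assumes "glued T q r l" "1 \<le> l" "1 \<le> k"
  shows "min (sum_end (E q) k) l = min (sum_end (E r) k) l"
proof (cases "l \<le> k")
  case True
  then show ?thesis using sum_end_gt[OF assms(3), of q] sum_end_gt[OF assms(3), of r] by simp
next
  case False
  then have kl: "k < l" by simp
  have "\<forall>i. \<forall>l\<ge>1. \<exists>U. finite_subtree T (node T i l) U \<and>
      lab T (node T i l) = (\<Sum>x \<in> U - {node T i l}. lab T x)"
    using T_tau by (simp add: tau_def)
  then obtain U where U: "finite_subtree T (node T q k) U"
    and sum: "lab T (node T q k) = (\<Sum>x \<in> U - {node T q k}. lab T x)"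
    using assms(3) by meson
  have levels: "{x. 1 \<le> x \<and> node T h x \<in> U} = {k..sum_end (E h) k}" if h: "glued T q h k" for h
  proof -
    obtain L where L: "k \<le> L" "{x. 1 \<le> x \<and> node T h x \<in> U} = {k..L}"
      using finite_subtree_levels[OF U assms(3) h] by blast
    have "node T h x = node T q k \<longleftrightarrow> x = k" if "1 \<le> x" for x
      using node_level[OF that assms(3), of h q] h by (metis glued_def)
    then have "{x. 1 \<le> x \<and> node T h x \<in> U - {node T q k}} = {x. 1 \<le> x \<and> node T h x \<in> U} - {k}"
      by blast
    also have "\<dots> = {k + 1..L}" unfolding L(2) by auto
    finally have K: "{x. 1 \<le> x \<and> node T h x \<in> U - {node T q k}} = {k + 1..L}" .
    have "E h k = lab T (node T q k) $ h" using h assms(3) by (simp add: lab_nth)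
    also have "\<dots> = (\<Sum>x \<in> U - {node T q k}. lab T x) $ h" by (rule arg_cong[OF sum])
    also have "\<dots> = (\<Sum>x = k + 1..L. E h x)"
      unfolding K[symmetric] by (rule sum_lab_nth) (use U in \<open>auto simp: finite_subtree_def\<close>)
    finally have sum_h: "E h k = (\<Sum>x = k + 1..L. E h x)" .
    \<comment> \<open>A positive entry is not an empty sum, which gives the strict bound in
      \<open>is_sum_end\<close>.\<close>
    then have "k \<noteq> L" using pos[OF assms(3), of h] by auto
    with sum_h have "sum_end (E h) k = L"
      using L(1) assms(3) by (intro sum_end_eqI) (auto simp: is_sum_end_def)
    then show ?thesis using L(2) by simp
  qed
  have "x \<le> sum_end (E q) k \<longleftrightarrow> x \<le> sum_end (E r) k" if x: "x \<le> l" for x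
  proof (cases "k \<le> x")
    case True
    then have "node T q x = node T r x" using glued_le[of x l q r] x assms by (simp add: glued_def)
    moreover have "glued T q r k" using glued_le[of k l q r] kl assms by simp
    moreover have "node T h x \<in> U \<longleftrightarrow> x \<le> sum_end (E h) k" if "glued T q h k" for h
    proof -
      have "x \<in> {x. 1 \<le> x \<and> node T h x \<in> U} \<longleftrightarrow> x \<in> {k..sum_end (E h) k}"
        unfolding levels[OF that] ..
      then show ?thesis using True assms(3) by simp
    qed
    ultimately show ?thesis by (metis glued_refl)
  next
    case False
    then show ?thesis using sum_end_gt[OF assms(3), of q] sum_end_gt[OF assms(3), of r] by simp
  qed
  then show ?thesis by (simp add: min_eq_min_iff)
qed

text \<open>A subtree from the root meets branch \<open>h\<close> in an initial segment, whose
  length is \<open>j h\<close>; shared nodes yield the equations.\<close>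

lemma tree_semigroup_subset:
  assumes "finite_subtree T (root T) U"
  shows "\<exists>j. (\<Sum>x\<in>U. lab T x) = V_E E j \<and>
    (\<forall>q r l. 1 \<le> l \<longrightarrow> glued T q r l \<longrightarrow> min (j q) l = min (j r) l)"
proof -
  have "\<exists>L. {k. 1 \<le> k \<and> node T h k \<in> U} = {1..L}" for h
    using finite_subtree_levels[OF assms[unfolded root_def] _ glued_1] by auto
  then obtain j where j: "\<And>h. {k. 1 \<le> k \<and> node T h k \<in> U} = {1..j h}" by metis
  have "(\<Sum>x\<in>U. lab T x) $ h = V_E E j $ h" for h
    using assms sum_lab_nth[of U h] unfolding j by (simp add: finite_subtree_def V_E_nth psum_def)
  then have sum: "(\<Sum>x\<in>U. lab T x) = V_E E j" by (simp add: vec_eq_iff)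
  have memU: "node T h k \<in> U \<longleftrightarrow> k \<le> j h" if "1 \<le> k" for h k
    using j[of h] that by (metis (no_types, lifting) atLeastAtMost_iff mem_Collect_eq)
  have "min (j q) l = min (j r) l" if l: "1 \<le> l" "glued T q r l" for q r l
  proof -
    have "x \<le> j q \<longleftrightarrow> x \<le> j r" if x: "x \<le> l" for x
    proof (cases "x = 0")
      case False
      then have x1: "1 \<le> x" by simp
      have "node T q x = node T r x" using glued_le[of x l q r] x x1 l by (simp add: glued_def)
      then show ?thesis using memU[OF x1, of q] memU[OF x1, of r] by simp
    qed simp
    then show ?thesis by (simp add: min_eq_min_iff)
  qed
  then show ?thesis using sum by blast
qed

lemma tree_semigroup_eq:
  "tree_semigroup T = {V_E E j | j. \<forall>q r l. 1 \<le> l \<longrightarrow> glued T q r l \<longrightarrow> min (j q) l = min (j r) l}"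
    (is "_ = ?R")
proof
  have "0 = V_E E (\<lambda>_. 0)" by (simp add: vec_eq_iff V_E_nth)
  then have "0 \<in> ?R" by auto
  then show "tree_semigroup T \<subseteq> ?R"
    unfolding tree_semigroup_def using tree_semigroup_subset by blast
  show "?R \<subseteq> tree_semigroup T"
  proof
    fix x assume "x \<in> ?R"
    then obtain j where x: "x = V_E E j"
      and j: "\<And>q r l. 1 \<le> l \<Longrightarrow> glued T q r l \<Longrightarrow> min (j q) l = min (j r) l" by blast
    show "x \<in> tree_semigroup T"
    \<comment> \<open>Subtrees contain the root, so an index 0 has to lead to the separate element
      0.\<close>
    proof (cases "\<exists>i. j i = 0")
      case True
      then obtain i where "j i = 0" by blast
      then have "j h = 0" for h using j[OF _ glued_1, of h i] by simp
      then have "x = 0" using x by (simp add: vec_eq_iff V_E_nth)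
      then show ?thesis by (simp add: tree_semigroup_def)
    next
      case False
      then have jpos: "1 \<le> j i" for i by (simp add: Suc_le_eq)
      \<comment> \<open>Each branch is cut at \<open>j i\<close>. The equations make the cuts agree
        on shared nodes, so no branch receives nodes beyond its own cut.\<close>
      define U where "U = {node T i k | i k. 1 \<le> k \<and> k \<le> j i}"
      have memU: "node T h k \<in> U \<longleftrightarrow> k \<le> j h" if "1 \<le> k" for h k
      proof
        assume "node T h k \<in> U"
        then obtain i k' where i: "node T h k = node T i k'" "1 \<le> k'" "k' \<le> j i" by (auto simp: U_def)
        then have "k' = k" using node_level[OF that i(2,1)] by simp
        then show "k \<le> j h" using j[OF that, of h i] i by (simp add: glued_def)
      qed (use that in \<open>auto simp: U_def\<close>)
      have "U \<subseteq> (\<Union>i. node T i ` {1..j i})" unfolding U_def by force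
      then have fin: "finite U" by (rule finite_subset) simp
      have path: "(root T, node T h (Suc k)) \<in> (edges T \<inter> U \<times> U)\<^sup>*" if "Suc k \<le> j h" for h k
        using that
      proof (induction k)
        case 0
        have "root T = node T h 1" using glued_1 by (simp add: root_def glued_def)
        then show ?case by simp
      next
        case (Suc k)
        have "(node T h (Suc k), node T h (Suc (Suc k))) \<in> edges T \<inter> U \<times> U"
          using Suc.prems memU[of "Suc k" h] memU[of "Suc (Suc k)" h] by (auto simp: edges_def)
        then show ?case using Suc by (meson Suc_leD rtrancl.rtrancl_into_rtrancl)
      qed
      have "finite_subtree T (root T) U"
        unfolding finite_subtree_def
      proof (intro conjI ballI)
        show "finite U" by (rule fin)
        show "U \<subseteq> nodes T" by (auto simp: U_def nodes_def)
        show "root T \<in> U" using memU[of 1] jpos by (simp add: root_def)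
        show "(root T, y) \<in> (edges T \<inter> U \<times> U)\<^sup>*" if "y \<in> U" for y
        proof -
          obtain h k where "y = node T h k" "1 \<le> k" "k \<le> j h" using \<open>y \<in> U\<close> unfolding U_def by blast
          then show ?thesis using path[of "k - 1" h] by simp
        qed
      qed
      moreover have "(\<Sum>y\<in>U. lab T y) = x"
      proof -
        have "{k. 1 \<le> k \<and> node T h k \<in> U} = {1..j h}" for h using memU by auto
        moreover have "U \<subseteq> nodes T" by (auto simp: U_def nodes_def)
        ultimately show ?thesis
          unfolding x vec_eq_iff using sum_lab_nth[OF fin] by (simp add: V_E_nth psum_def)
      qed
      ultimately show ?thesis unfolding tree_semigroup_def by blast
    qed
  qed
qed

text \<open>Far out the labels are distinct unit vectors, so the levels of gluing are bounded; level
  1 is among them. Hence \<open>Max\<close> is a true maximum.\<close>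

lemma glued_iff_le_glue_level:
  assumes "q \<noteq> r" "1 \<le> l"
  shows "glued T q r l \<longleftrightarrow> l \<le> glue_level T q r"
proof -
  let ?A = "{l. 1 \<le> l \<and> glued T q r l}"
  obtain L where L: "\<forall>l\<ge>L. \<forall>i. lab T (node T i l) = axis i 1"
    using T_tau unfolding tau_def mem_Collect_eq by blast
  have "x < L" if "x \<in> ?A" for x
  proof (rule ccontr)
    assume "\<not> x < L"
    then have "axis q (1::nat) = axis r 1" using L that by (metis (mono_tags) glued_def mem_Collect_eq not_less)
    then show False using assms(1) by (simp add: axis_eq_axis)
  qed
  then have fin: "finite ?A" by (meson finite_nat_set_iff_bounded)
  have "Max ?A \<in> ?A" using fin glued_1 by (intro Max_in) auto
  then show ?thesis
    unfolding glue_level_def using fin assms(2) glued_le[of l "Max ?A" q r] by auto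
qed

lemma glue_level_ge_1: "q \<noteq> r \<Longrightarrow> 1 \<le> glue_level T q r"
  using glued_iff_le_glue_level[of q r 1] glued_1 by simp

end

section \<open>Arf closures and the equivalence\<close>

text \<open>A minimum for inclusion is unique, so the description in \<open>Arf\<close> selects
  it.\<close>

lemma Arf_eq_iff: "Arf_well_defined G \<and> Arf G = S \<longleftrightarrow> is_Arf_closure G S"
proof -
  have uniq: "A = B" if "is_Arf_closure G A" "is_Arf_closure G B" for A B
    using that unfolding is_Arf_closure_def by blast
  then have "Arf G = A" if "is_Arf_closure G A" for A
    unfolding Arf_def using that by (intro the_equality) auto
  then show ?thesis unfolding Arf_well_defined_def by metis
qed

theorem theorem4p1:
  fixes E :: "'n::{finite,linorder} \<Rightarrow> nat \<Rightarrow> nat"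
    and T :: "('n, 'v) ltree"
    and Gen :: "nat \<Rightarrow> (nat, 'n) vec"
    and t :: nat
  assumes "\<And>i. multiplicity_sequence (E i)"
    and "T \<in> tau E"
  shows "(Arf_well_defined (Gen ` {1..t}) \<and> Arf (Gen ` {1..t}) = tree_semigroup T) \<longleftrightarrow>
    (\<exists>j :: nat \<Rightarrow> 'n \<Rightarrow> nat.
       (\<forall>p\<in>{1..t}. Gen p = V_E E (j p)) \<and>
       (\<forall>i. PChar E i \<subseteq> {j p i | p. p \<in> {1..t}}) \<and>
       (\<forall>(q, r) \<in> P_set E T.
          (\<forall>p\<in>{1..t}. j p q = j p r) \<or>
          (MIN_well_defined t j q r \<and> MIN_G E t j q r = k_E E q r)) \<and>
       (\<forall>q r. q < r \<and> (q, r) \<notin> P_set E T \<longrightarrow>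
          MIN_well_defined t j q r \<and> MIN_G E t j q r = enat (glue_level T q r)))"
    (is "?closure \<longleftrightarrow> (\<exists>j. ?cond j)")
proof -
  interpret multiplicity_tree E T by standard (fact assms)+
  define C where "C = {(q, r, l). 1 \<le> l \<and> glued T q r l}"
  let ?p = "glue_level T"
  have C_le: "l \<le> ?p q r" if "(q, r, l) \<in> C" "q \<noteq> r" for q r l
    using that glued_iff_le_glue_level by (auto simp: C_def)
  have C_p: "(q, r, ?p q r) \<in> C" if "q \<noteq> r" for q r
    using that glued_iff_le_glue_level glue_level_ge_1 by (auto simp: C_def)
  have C_bdd: "\<exists>L. \<forall>(q, r, l)\<in>C. q \<noteq> r \<longrightarrow> l \<le> L"
  proof -
    have "?p q r \<le> (\<Sum>q\<in>UNIV. \<Sum>r\<in>UNIV. ?p q r)" for q r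
      by (rule order_trans[OF member_le_sum[of r UNIV] member_le_sum[of q UNIV "\<lambda>q. \<Sum>r\<in>UNIV. ?p q r"]]) simp_all
    then show ?thesis
      by (intro exI[of _ "\<Sum>q\<in>UNIV. \<Sum>r\<in>UNIV. ?p q r"]) (clarify, blast intro: le_trans C_le)
  qed
  have constraints: "index_constraints E C (\<lambda>_. {})"
    by standard (use mult_E min_sum_end_glued glued_1 C_bdd in \<open>auto simp: C_def\<close>)
  interpret base: index_constraints E C "\<lambda>_. {}" by (rule constraints)
  have tree: "tree_semigroup T = base.semigroup_of"
    unfolding tree_semigroup_eq base.semigroup_of_def admissible_def by (simp add: C_def imp_conjL)
  have mem_tree: "V_E E j \<in> tree_semigroup T \<longleftrightarrow> (\<forall>q r. q \<noteq> r \<longrightarrow> min (j q) (?p q r) = min (j r) (?p q r))" for j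
  proof -
    have "V_E E j \<in> tree_semigroup T \<longleftrightarrow> admissible C (\<lambda>_. {}) j"
      unfolding tree base.semigroup_of_def by auto
    also have "\<dots> \<longleftrightarrow> (\<forall>q r. q \<noteq> r \<longrightarrow> min (j q) (?p q r) = min (j r) (?p q r))" (is "_ \<longleftrightarrow> ?R")
    proof
      assume R: ?R
      show "admissible C (\<lambda>_. {}) j"
      proof (rule admissibleI)
        fix q r l assume qr: "(q, r, l) \<in> C"
        show "min (j q) l = min (j r) l"
        proof (cases "q = r")
          case False
          then have "min (j q) (?p q r) = min (j r) (?p q r)" using R by blast
          then show ?thesis using C_le[OF qr False] by linarith
        qed simp
      qed simp
    next
      assume "admissible C (\<lambda>_. {}) j"
      then show ?R using admissibleD(1)[OF _ C_p] by blast
    qed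
    finally show ?thesis .
  qed
  have p_le_k: "enat (?p q r) \<le> k_E E q r" if "q \<noteq> r" for q r
    unfolding enat_le_k_E_iff using base.C_sum_end[OF C_p[OF that]] by blast
  have p_sym: "?p q r = ?p r q" for q r
    by (simp add: glue_level_def glued_sym)
  \<comment> \<open>For generators in \<open>S(T)\<close> neither \<open>k_E\<close> nor any term of
    the minimum is below \<open>glue_level\<close>, so equality means that one of them attains
    it.\<close>
  have MIN_eq: "MIN_well_defined t j q r \<and> MIN_G E t j q r = enat (?p q r) \<longleftrightarrow>
      (\<exists>p\<in>{1..t}. j p q \<noteq> j p r) \<and> (enat (?p q r) = k_E E q r \<or> (\<exists>p\<in>{1..t}. j p q \<noteq> j p r \<and> min (j p q) (j p r) = ?p q r))"
    if "q \<noteq> r" and j: "\<And>p. p \<in> {1..t} \<Longrightarrow> min (j p q) (?p q r) = min (j p r) (?p q r)" for j q r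
  proof (cases "\<exists>p\<in>{1..t}. j p q \<noteq> j p r")
    case True
    define A where "A = {min (j p q) (j p r) | p. p \<in> {1..t} \<and> j p q \<noteq> j p r}"
    have A: "finite A" "A \<noteq> {}" using True by (auto simp: A_def)
    have ge: "?p q r \<le> a" if "a \<in> A" for a
    proof -
      obtain p where p: "p \<in> {1..t}" "j p q \<noteq> j p r" "a = min (j p q) (j p r)"
        using \<open>a \<in> A\<close> unfolding A_def by blast
      show ?thesis using j[OF p(1)] p(2,3) by linarith
    qed
    have "Min A = ?p q r \<longleftrightarrow> ?p q r \<in> A"
      using A ge by (metis Min_eqI Min_in)
    moreover have "?p q r \<le> Min A" using A ge by simp
    ultimately have "min (k_E E q r) (enat (Min A)) = enat (?p q r) \<longleftrightarrow> enat (?p q r) = k_E E q r \<or> ?p q r \<in> A"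
      using p_le_k[OF that(1)] by (cases "k_E E q r") (auto simp: min_def)
    moreover have "?p q r \<in> A \<longleftrightarrow> (\<exists>p\<in>{1..t}. j p q \<noteq> j p r \<and> min (j p q) (j p r) = ?p q r)"
      by (auto simp: A_def intro: sym)
    ultimately show ?thesis using True unfolding MIN_G_def MIN_well_defined_def A_def[symmetric] by blast
  qed (auto simp: MIN_well_defined_def)
  \<comment> \<open>The conditions on \<open>MIN_G\<close> amount to the generators lying in
    \<open>S(T)\<close> and, for each pair with \<open>glue_level\<close> different from
    \<open>k_E\<close>, a generator separating it at the exact level. Symmetry in \<open>q\<close>
    and \<open>r\<close> removes the order of the pair.\<close>
  have cond_iff: "?cond j \<longleftrightarrow>
      (\<forall>p\<in>{1..t}. Gen p = V_E E (j p)) \<and> (\<forall>i. PChar E i \<subseteq> {j p i | p. p \<in> {1..t}}) \<and>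
      (\<forall>p\<in>{1..t}. V_E E (j p) \<in> tree_semigroup T) \<and>
      (\<forall>q r. q \<noteq> r \<and> enat (?p q r) \<noteq> k_E E q r \<longrightarrow>
         (\<exists>p\<in>{1..t}. j p q \<noteq> j p r \<and> min (j p q) (j p r) = ?p q r))"
    (is "_ \<longleftrightarrow> ?cond' j") for j
  proof
    assume cond: "?cond j"
    have wd: "(\<forall>p\<in>{1..t}. j p q = j p r) \<or> MIN_well_defined t j q r \<and> MIN_G E t j q r = enat (?p q r)"
      if "q < r" for q r
    proof (cases "(q, r) \<in> P_set E T")
      case True
      have "\<forall>(q, r)\<in>P_set E T. (\<forall>p\<in>{1..t}. j p q = j p r) \<or> (MIN_well_defined t j q r \<and> MIN_G E t j q r = k_E E q r)"
        using cond by (elim conjE)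
      from bspec[OF this True] show ?thesis using True by (simp add: P_set_def)
    next
      case False
      then show ?thesis using cond that by blast
    qed
    have less: "min (j p q) (?p q r) = min (j p r) (?p q r)" if "q < r" "p \<in> {1..t}" for p q r
    proof (cases "j p q = j p r")
      case False
      then have "MIN_G E t j q r = enat (?p q r)" using wd[OF that(1)] that(2) by blast
      then have "?p q r \<le> min (j p q) (j p r)" using MIN_le[of p t j q r E, OF that(2) False] by simp
      then show ?thesis by simp
    qed simp
    have tree_cond: "min (j p q) (?p q r) = min (j p r) (?p q r)" if "q \<noteq> r" "p \<in> {1..t}" for p q r
      using less[of q r p] less[of r q p] p_sym[of q r] that by (metis linorder_neq_iff)
    have sep: "\<exists>p\<in>{1..t}. j p q \<noteq> j p r \<and> min (j p q) (j p r) = ?p q r"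
      if "q < r" "enat (?p q r) \<noteq> k_E E q r" for q r
    proof -
      have "MIN_well_defined t j q r \<and> MIN_G E t j q r = enat (?p q r)"
        using cond that by (simp add: P_set_def)
      moreover have "q \<noteq> r" using that(1) by simp
      ultimately show ?thesis using MIN_eq[of q r j, OF _ tree_cond] that(2) by blast
    qed
    have "\<exists>p\<in>{1..t}. j p q \<noteq> j p r \<and> min (j p q) (j p r) = ?p q r"
      if "q \<noteq> r" "enat (?p q r) \<noteq> k_E E q r" for q r
    proof (cases "q < r")
      case False
      then show ?thesis
        using sep[of r q] that p_sym[of q r] k_E_commute[of E q r] by (metis linorder_neq_iff min.commute)
    qed (use sep that in blast)
    then show "?cond' j" using cond tree_cond unfolding mem_tree by blast
  next
    assume cond: "?cond' j"
    then have tree_cond: "min (j p q) (?p q r) = min (j p r) (?p q r)" if "q \<noteq> r" "p \<in> {1..t}" for p q r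
      using that unfolding mem_tree by blast
    have glued_P: "\<forall>(q, r)\<in>P_set E T.
      (\<forall>p\<in>{1..t}. j p q = j p r) \<or> (MIN_well_defined t j q r \<and> MIN_G E t j q r = k_E E q r)"
    proof (intro ballI, goal_cases)
      case (1 x)
      obtain q r where x: "x = (q, r)" by force
      then have qr: "q \<noteq> r" "k_E E q r = enat (?p q r)" using 1 by (auto simp: P_set_def)
      then show ?case unfolding x using MIN_eq[of q r j, OF qr(1) tree_cond[OF qr(1)]] by auto
    qed
    have glued_not_P: "\<forall>q r. q < r \<and> (q, r) \<notin> P_set E T \<longrightarrow>
      MIN_well_defined t j q r \<and> MIN_G E t j q r = enat (?p q r)"
    proof (intro allI impI)
      fix q r assume "q < r \<and> (q, r) \<notin> P_set E T"
      then have qr: "q \<noteq> r" "enat (?p q r) \<noteq> k_E E q r" by (auto simp: P_set_def)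
      then have "\<exists>p\<in>{1..t}. j p q \<noteq> j p r \<and> min (j p q) (j p r) = ?p q r" using cond by blast
      then show "MIN_well_defined t j q r \<and> MIN_G E t j q r = enat (?p q r)"
        using MIN_eq[of q r j, OF qr(1) tree_cond[OF qr(1)]] by blast
    qed
    show "?cond j"
      using cond by (elim conjE, intro conjI) (assumption | rule glued_P | rule glued_not_P)+
  qed
  have "is_Arf_closure (Gen ` {1..t}) (tree_semigroup T) \<longleftrightarrow> (\<exists>j. ?cond' j)"
  proof
    assume closure: "is_Arf_closure (Gen ` {1..t}) (tree_semigroup T)"
    then have sub: "Gen p \<in> tree_semigroup T" if "p \<in> {1..t}" for p
      using that by (auto simp: is_Arf_closure_def)
    then have "\<forall>p\<in>{1..t}. \<exists>j. Gen p = V_E E j" unfolding tree_semigroup_eq by blast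
    then obtain j where j: "\<forall>p\<in>{1..t}. Gen p = V_E E (j p)" by metis
    have adm: "admissible C (\<lambda>_. {}) (j p)" if "p \<in> {1..t}" for p
      using sub[OF that] that j unfolding tree base.semigroup_of_def by auto
    \<comment> \<open>Minimality as a test: valid constraints respected by the generators hold on
      all of \<open>S(T)\<close>.\<close>
    have least: "admissible C' F k"
      if S': "index_constraints E C' F" and gen: "\<And>p. p \<in> {1..t} \<Longrightarrow> admissible C' F (j p)"
        and k: "V_E E k \<in> tree_semigroup T" for C' F k
    proof -
      interpret S': index_constraints E C' F by (rule S')
      have "Gen ` {1..t} \<subseteq> S'.semigroup_of"
        using j gen unfolding S'.semigroup_of_def by auto
      then have "V_E E k \<in> S'.semigroup_of"
        using closure k S'.Arf_semigroup_of unfolding is_Arf_closure_def by blast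
      then show ?thesis unfolding S'.semigroup_of_def by auto
    qed
    have "PChar E i \<subseteq> {j p i | p. p \<in> {1..t}}" for i
    proof (rule ccontr)
      assume "\<not> ?thesis"
      then obtain c where c: "c \<in> PChar E i" "\<And>p. p \<in> {1..t} \<Longrightarrow> j p i \<noteq> c" by blast
      \<comment> \<open>Only the missing character is forbidden, and only on branch
        \<open>i\<close>; the constant index vector \<open>c\<close> gives an element of
        \<open>S(T)\<close> that violates this.\<close>
      define F where "F = (\<lambda>_. {} :: nat set)(i := {c})"
      have "index_constraints E C F"
        using constraints c(1) unfolding index_constraints_def PChar_iff[of E, OF mult_E]
        by (auto simp: F_def)
      moreover have "admissible C F (j p)" if "p \<in> {1..t}" for p
        using adm[OF that] c(2)[OF that] by (auto simp: admissible_def F_def)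
      moreover have "V_E E (\<lambda>_. c) \<in> tree_semigroup T" unfolding mem_tree by blast
      ultimately have "admissible C F (\<lambda>_. c)" by (rule least)
      then show False using admissibleD(2)[of C F "\<lambda>_. c" i] by (simp add: F_def)
    qed
    moreover have "\<exists>p\<in>{1..t}. j p q \<noteq> j p r \<and> min (j p q) (j p r) = ?p q r"
      if qr: "q \<noteq> r" "enat (?p q r) \<noteq> k_E E q r" for q r
    proof (rule ccontr)
      assume no: "\<not> ?thesis"
      define a where "a = ?p q r"
      \<comment> \<open>There is room for one more level up to \<open>k_E\<close>, so gluing
        \<open>q\<close> and \<open>r\<close> there keeps the sum ends compatible.\<close>
      have "enat (Suc a) \<le> k_E E q r"
        using p_le_k[OF qr(1)] qr(2) unfolding a_def by (cases "k_E E q r") auto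
      moreover obtain L where "\<forall>(q, r, l)\<in>C. q \<noteq> r \<longrightarrow> l \<le> L" using C_bdd by blast
      then have "\<forall>(q', r', l)\<in>insert (q, r, Suc a) C. q' \<noteq> r' \<longrightarrow> l \<le> max (Suc a) L" by fastforce
      then have "\<exists>L. \<forall>(q', r', l)\<in>insert (q, r, Suc a) C. q' \<noteq> r' \<longrightarrow> l \<le> L" by (rule exI)
      ultimately have "index_constraints E (insert (q, r, Suc a) C) (\<lambda>_. {})"
        using constraints unfolding index_constraints_def enat_le_k_E_iff by auto
      moreover have "admissible (insert (q, r, Suc a) C) (\<lambda>_. {}) (j p)" if p: "p \<in> {1..t}" for p
      proof -
        have "min (j p q) a = min (j p r) a"
          using admissibleD(1)[OF adm[OF p] C_p[OF qr(1)]] by (simp add: a_def)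
        moreover have "j p q = j p r \<or> min (j p q) (j p r) \<noteq> a" using no p by (auto simp: a_def)
        \<comment> \<open>Distinct indices with equal truncations at \<open>a\<close> and minimum
          other than \<open>a\<close> are both at least \<open>Suc a\<close>.\<close>
        ultimately have "min (j p q) (Suc a) = min (j p r) (Suc a)" by linarith
        then show ?thesis using adm[OF p] by (auto simp: admissible_def)
      qed
      \<comment> \<open>Branches glued to \<open>q\<close> at level \<open>Suc a\<close> stop at
        \<open>a\<close>, all others one level later. This respects every gluing of \<open>T\<close>
        but differs on \<open>q\<close> and \<open>r\<close>.\<close>
      moreover define k where "k x = (if glued T q x (Suc a) then a else Suc a)" for x
      have "min (k x) (?p x y) = min (k y) (?p x y)" if "x \<noteq> y" for x y
      proof (cases "glued T x y (Suc a)")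
        case True
        then have "k x = k y" unfolding k_def glued_def by simp
        then show ?thesis by simp
      next
        case False
        then have "?p x y \<le> a" using glued_iff_le_glue_level[OF that, of "Suc a"] by simp
        then show ?thesis unfolding k_def by auto
      qed
      then have "V_E E k \<in> tree_semigroup T" unfolding mem_tree by blast
      ultimately have "admissible (insert (q, r, Suc a) C) (\<lambda>_. {}) k" by (rule least)
      then have "min (k q) (Suc a) = min (k r) (Suc a)" by (rule admissibleD) simp
      moreover have "\<not> glued T q r (Suc a)"
        using glued_iff_le_glue_level[OF qr(1), of "Suc a"] by (simp add: a_def)
      ultimately show False by (simp add: k_def)
    qed
    ultimately show "\<exists>j. ?cond' j" using j sub by (intro exI[of _ j]) auto
  next
    assume "\<exists>j. ?cond' j"
    then obtain j where j: "\<forall>p\<in>{1..t}. Gen p = V_E E (j p)"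
      and char: "\<forall>i. PChar E i \<subseteq> {j p i | p. p \<in> {1..t}}"
      and tree_mem: "\<forall>p\<in>{1..t}. V_E E (j p) \<in> tree_semigroup T"
      and sep: "\<forall>q r. q \<noteq> r \<and> enat (?p q r) \<noteq> k_E E q r \<longrightarrow>
         (\<exists>p\<in>{1..t}. j p q \<noteq> j p r \<and> min (j p q) (j p r) = ?p q r)" by blast
    have "tree_semigroup T \<subseteq> S'" if S': "Arf_semigroup S'" "Gen ` {1..t} \<subseteq> S'" for S'
    proof
      interpret gens: Arf_generators E S' "j ` {1..t}"
      proof
        show "V_E E i \<in> S'" if "i \<in> j ` {1..t}" for i using that j S'(2) by force
        show "PChar E i \<subseteq> (\<lambda>j. j i) ` j ` {1..t}" for i using char by fastforce
      qed (use mult_E S' in auto)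
      fix x assume "x \<in> tree_semigroup T"
      then obtain k where k: "x = V_E E k" "V_E E k \<in> tree_semigroup T" unfolding tree_semigroup_eq by blast
      have "V_E E k \<in> S'"
      proof (rule gens.V_E_mem[of ?p])
        fix q r :: 'n assume qr: "q \<noteq> r"
        show "min (sum_end (E q) l) (?p q r) = min (sum_end (E r) l) (?p q r)" if "1 \<le> l" for l
          using base.C_sum_end[OF C_p[OF qr] that] .
        show "min (i q) (?p q r) = min (i r) (?p q r)" if "i \<in> j ` {1..t}" for i
          using that tree_mem qr unfolding mem_tree by blast
        show "min (k q) (?p q r) = min (k r) (?p q r)" using k(2) qr unfolding mem_tree by blast
        show "(\<exists>i\<in>j ` {1..t}. i q \<noteq> i r \<and> min (i q) (i r) = ?p q r) \<or>
          (\<exists>l\<ge>1. sum_end (E q) l \<noteq> sum_end (E r) l \<and> min (sum_end (E q) l) (sum_end (E r) l) = ?p q r)"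
        proof (cases "enat (?p q r) = k_E E q r")
          case True
          \<comment> \<open>One level beyond \<open>k_E\<close>, some pair of sum ends no longer has
            equal truncations; equality at the level itself puts their minimum exactly
            there.\<close>
          then obtain l where "1 \<le> l" "min (sum_end (E q) l) (?p q r + 1) \<noteq> min (sum_end (E r) l) (?p q r + 1)"
            using enat_le_k_E_iff[of "?p q r + 1" E q r] by (metis Suc_eq_plus1 Suc_n_not_le_n enat_ord_simps(1))
          moreover from this have "min (sum_end (E q) l) (?p q r) = min (sum_end (E r) l) (?p q r)"
            using base.C_sum_end[OF C_p[OF qr]] by blast
          ultimately have "1 \<le> l \<and> sum_end (E q) l \<noteq> sum_end (E r) l \<and> min (sum_end (E q) l) (sum_end (E r) l) = ?p q r"
            by linarith
          then show ?thesis by blast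
        next
          case False
          then show ?thesis using sep qr by blast
        qed
      qed
      then show "x \<in> S'" using k(1) by simp
    qed
    moreover have "Gen ` {1..t} \<subseteq> tree_semigroup T" using j tree_mem by auto
    ultimately show "is_Arf_closure (Gen ` {1..t}) (tree_semigroup T)"
      unfolding is_Arf_closure_def tree using base.Arf_semigroup_of by blast
  qed
  then show ?thesis unfolding Arf_eq_iff cond_iff .
qed

end
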